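(* Let $p>1$ and $x\in C([0,1];\mathbb R)$ with $a:=x(1)-x(0)$ and dyadic Faber–Schauder coefficients $\theta=(\theta_{m,k})$. Assume $$\sup_{m,k}2^{m(1/p-1/2)}|\theta_{m,k}|<\infty,$$ $x\in V_p(\mathbb T)$, and $[x]^p_{\mathbb T}(1)>0$. Suppose that the coefficients have the fixed-amplitude form $\theta_{m,k}=c_m\sigma_{m,k}$ with $\sigma_{m,k}\in\{-1,1\}$ and a real sequence $(c_m)$. If there exist constants $C<\infty$ and $0<\eta\le1$ such that for every $m\ge1$, every $1\le b\le2^m$, every $0\le r<b$, and every consecutive family $q=q_0,\dots,q_0+M-1$ of $M\ge1$ full $(b,r)$-blocks, $$\left|\sum_{q=q_0}^{q_0+M-1}G^{p;b,r}_{m,q}(\sigma)\right|\le CM^{1-\eta},$$ then $x$ is $p$-rough. More precisely, $$\mathfrak R_{p,L}(x)\le C'\left(L^{-\eta}+L^{-1}\right),\qquad L\ge2,$$ for a constant $C'$ depending only on $p$, the critical ($1/p$-)Hölder bound of $x$ and the constant $C$.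
   Context: $p$-roughness on $[0,1]$: for a finite partition $\lambda=\{0=u_0<\dots<u_N=1\}$ put $\mathsf V^p_\lambda(x;t):=\sum_i|x(u_{i+1}\wedge t)-x(u_i\wedge t)|^p$; for $0<\ell\le1$, $0\le s<\ell$ put $\Pi(\ell,s):=\{0,1\}\cup\{s+k\ell:k\in\mathbb Z,\ 0<s+k\ell<1\}$. $x$ is $p$-rough if there is a continuous nondecreasing $A:[0,1]\to[0,\infty)$ with $A(1)>A(0)=0$ such that $\sup_{0<\ell\le\delta}\sup_{0\le s<\ell}\sup_{t\in[0,1]}|\mathsf V^p_{\Pi(\ell,s)}(x;t)-A(t)|\to0$ as $\delta\downarrow0$. $\mathbb T_m:=\{j2^{-m}:0\le j\le2^m\}$, $\mathbb T=(\mathbb T_m)_m$. $x\in V_p(\mathbb T)$ means that the measures $\sum_{j<2^m}|x((j+1)2^{-m})-x(j2^{-m})|^p\delta_{j2^{-m}}$ converge weakly to a finite nonatomic Borel measure $\mu$ on $[0,1]$; then $[x]^p_{\mathbb T}(t):=\mu([0,t])$. For integers $1\le b\le2^m$, $0\le r<b$: $\mathbb T_m^{b,r}:=\{0,1\}\cup\{j2^{-m}:1\le j<2^m,\ j\equiv r\pmod b\}$. For integers $L\ge2$, $\mathfrak R_{p,L}(x):=\limsup_{m\to\infty}\sup_{L\le b\le\lfloor2^m/L\rfloor,\,0\le r<b}\sup_{t\in[0,1]}|\mathsf V^p_{\mathbb T_m^{b,r}}(x;t)-\mathsf V^p_{\mathbb T_m}(x;t)|$. Faber–Schauder coefficients: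 $\theta_{m,k}=2^{m/2}\bigl(2x(\tfrac{2k+1}{2^{m+1}})-x(\tfrac k{2^m})-x(\tfrac{k+1}{2^m})\bigr)$, $m\ge0$, $0\le k<2^m$. For $0\le\ell<m$, $0\le j<2^m$: $\kappa(\ell;m,j):=\lfloor j/2^{m-\ell}\rfloor$, and $\varepsilon_\ell(m,j)=+1$ (resp. $-1$) if $(j2^{-m},(j+1)2^{-m})$ lies in the left (resp. right) half of $[\kappa2^{-\ell},(\kappa+1)2^{-\ell}]$, $\kappa=\kappa(\ell;m,j)$. Set $$\mathcal Z_{m,j}(a,\theta):=2^{-m(1-1/p)}\left[a+\sum_{\ell=0}^{m-1}2^{\ell/2}\theta_{\ell,\kappa(\ell;m,j)}\varepsilon_\ell(m,j)\right].$$ Block coarse-graining error: $\mathfrak D_p(a_1,\dots,a_n):=|\sum_{j=1}^na_j|^p-\sum_{j=1}^n|a_j|^p$. For given $(m,b,r)$, the full $(b,r)$-blocks $B^{b,r}_{m,q}$ are the consecutive (indexed by $q$ from left to right) index sets $B\subset\{0,\dots,2^m-1\}$ of exactly $b$ fine intervals $[j2^{-m},(j+1)2^{-m}]$ making up one cell of $\mathbb T_m^{b,r}$, and $$G^{p;b,r}_{m,q}(\sigma):=\frac1b\,\mathfrak D_p\bigl((\mathcal Z_{m,j}(a,\theta))_{j\in B^{b,r}_{m,q}}\bigr).$$ *)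

theory Defs
  imports "HOL-Analysis.Analysis" "HOL-Number_Theory.Cong"
begin

(* Functions on [0,1] are functions real => real of which only the values on {0..1} are used. *)

text \<open>A partition is the finite set of its points; its cells are the pairs of consecutive points.\<close>

definition cells :: "real set \<Rightarrow> (real \<times> real) set" where
  "cells P = {(u, v). u \<in> P \<and> v \<in> P \<and> u < v \<and> P \<inter> {u<..<v} = {}}"

definition pvariation :: "real \<Rightarrow> real set \<Rightarrow> (real \<Rightarrow> real) \<Rightarrow> real \<Rightarrow> real" where
  "pvariation p P x t = (\<Sum>(u, v)\<in>cells P. \<bar>x (min v t) - x (min u t)\<bar> powr p)"

definition shifted_grid :: "real \<Rightarrow> real \<Rightarrow> real set" where
  "shifted_grid l s = {0, 1} \<union> {s + of_int k * l | k :: int. 0 < s + of_int k * l \<and> s + of_int k * l < 1}"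

text \<open>The restriction \<open>l \<le> 1\<close> on the mesh is immaterial, since \<open>d\<close> tends to \<open>0\<close>.\<close>

definition p_rough :: "real \<Rightarrow> (real \<Rightarrow> real) \<Rightarrow> bool" where
  "p_rough p x \<longleftrightarrow>
    (\<exists>A :: real \<Rightarrow> real.
       continuous_on {0..1} A \<and> mono_on {0..1} A \<and> (\<forall>t\<in>{0..1}. 0 \<le> A t) \<and> A 0 = 0 \<and> A 1 > A 0 \<and>
       ((\<lambda>d. SUP l\<in>{0<..d}. SUP s\<in>{0..<l}. SUP t\<in>{0..1}.
            ereal \<bar>pvariation p (shifted_grid l s) x t - A t\<bar>) \<longlongrightarrow> 0) (at_right 0))"

definition dyadic_grid :: "nat \<Rightarrow> real set" where
  "dyadic_grid m = {real j / 2 ^ m | j :: nat. j \<le> 2 ^ m}"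

text \<open>The image of the weights on the index set \<open>{..<2^m}\<close> under \<open>j \<mapsto> j / 2^m\<close>, that is, the sum of
  the weighted point masses at the left endpoints, as a Borel measure on \<open>[0,1]\<close>.\<close>

definition dyadic_measure :: "real \<Rightarrow> (real \<Rightarrow> real) \<Rightarrow> nat \<Rightarrow> real measure" where
  "dyadic_measure p x m =
     distr (point_measure {..<2 ^ m}
              (\<lambda>j::nat. ennreal (\<bar>x (real (j + 1) / 2 ^ m) - x (real j / 2 ^ m)\<bar> powr p)))
           (restrict_space borel {0..1}) (\<lambda>j. real j / 2 ^ m)"

text \<open>Weak convergence is tested on the continuous (hence bounded) functions on \<open>[0,1]\<close>; nonatomic
  means that no point has positive mass.\<close>

definition is_dyadic_limit :: "real \<Rightarrow> (real \<Rightarrow> real) \<Rightarrow> real measure \<Rightarrow> bool" where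
  "is_dyadic_limit p x \<mu> \<longleftrightarrow>
     sets \<mu> = sets (restrict_space borel {0..1}) \<and> finite_measure \<mu> \<and>
     (\<forall>t\<in>{0..1}. emeasure \<mu> {t} = 0) \<and>
     (\<forall>f :: real \<Rightarrow> real. continuous_on {0..1} f \<longrightarrow>
        (\<lambda>m. integral\<^sup>L (dyadic_measure p x m) f) \<longlonglongrightarrow> integral\<^sup>L \<mu> f)"

definition V_dyadic :: "real \<Rightarrow> (real \<Rightarrow> real) set" where
  "V_dyadic p = {x. \<exists>\<mu>. is_dyadic_limit p x \<mu>}"

text \<open>Weak limits of finite Borel measures on \<open>[0,1]\<close> are unique, so the choice is immaterial.\<close>

definition dyadic_pvar :: "real \<Rightarrow> (real \<Rightarrow> real) \<Rightarrow> real \<Rightarrow> real" where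
  "dyadic_pvar p x t = measure (SOME \<mu>. is_dyadic_limit p x \<mu>) {0..t}"

definition coarse_grid :: "nat \<Rightarrow> nat \<Rightarrow> nat \<Rightarrow> real set" where
  "coarse_grid m b r = {0, 1} \<union> {real j / 2 ^ m | j :: nat. 1 \<le> j \<and> j < 2 ^ m \<and> [j = r] (mod b)}"

definition coarse_error :: "real \<Rightarrow> nat \<Rightarrow> (real \<Rightarrow> real) \<Rightarrow> ereal" where
  "coarse_error p L x =
     limsup (\<lambda>m. SUP (b, r)\<in>{(b, r). L \<le> b \<and> b \<le> 2 ^ m div L \<and> r < b}. SUP t\<in>{0..1}.
       ereal \<bar>pvariation p (coarse_grid m b r) x t - pvariation p (dyadic_grid m) x t\<bar>)"

definition fs_coeff :: "(real \<Rightarrow> real) \<Rightarrow> nat \<Rightarrow> nat \<Rightarrow> real" where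
  "fs_coeff x m k =
     2 powr (real m / 2) *
       (2 * x (real (2 * k + 1) / 2 ^ (m + 1)) - x (real k / 2 ^ m) - x (real (k + 1) / 2 ^ m))"

definition kappa :: "nat \<Rightarrow> nat \<Rightarrow> nat \<Rightarrow> nat" where
  "kappa l m j = j div 2 ^ (m - l)"

definition eps :: "nat \<Rightarrow> nat \<Rightarrow> nat \<Rightarrow> real" where
  "eps l m j =
     (if {real j / 2 ^ m<..<real (j + 1) / 2 ^ m}
           \<subseteq> {real (kappa l m j) / 2 ^ l..(real (kappa l m j) + 1 / 2) / 2 ^ l}
      then 1 else - 1)"

definition Z :: "real \<Rightarrow> nat \<Rightarrow> nat \<Rightarrow> real \<Rightarrow> (nat \<Rightarrow> nat \<Rightarrow> real) \<Rightarrow> real" where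
  "Z p m j a \<theta> =
     2 powr (- real m * (1 - 1 / p)) *
       (a + (\<Sum>l<m. 2 powr (real l / 2) * \<theta> l (kappa l m j) * eps l m j))"

definition cg_error :: "real \<Rightarrow> 'i set \<Rightarrow> ('i \<Rightarrow> real) \<Rightarrow> real" where
  "cg_error p B f = \<bar>\<Sum>j\<in>B. f j\<bar> powr p - (\<Sum>j\<in>B. \<bar>f j\<bar> powr p)"

text \<open>The full \<open>(b,r)\<close>-blocks at level \<open>m\<close>, from left to right, are \<open>block b r q\<close> for
  \<open>q = 0, 1, \<dots>\<close> as long as \<open>full_block m b r q\<close> holds; see the lemma below.\<close>

definition block :: "nat \<Rightarrow> nat \<Rightarrow> nat \<Rightarrow> nat set" where
  "block b r q = {r + q * b..<r + (q + 1) * b}"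

definition full_block :: "nat \<Rightarrow> nat \<Rightarrow> nat \<Rightarrow> nat \<Rightarrow> bool" where
  "full_block m b r q \<longleftrightarrow> r + (q + 1) * b \<le> 2 ^ m"

lemma coarse_grid_iff:
  assumes "r < b"
  shows "real i / 2 ^ m \<in> coarse_grid m b r \<longleftrightarrow> i = 0 \<or> i = 2 ^ m \<or> (i < 2 ^ m \<and> i mod b = r)"
  using assms unfolding coarse_grid_def cong_def by (cases "i = 0") auto

lemma coarse_gridE:
  assumes "y \<in> coarse_grid m b r"
  obtains i where "y = real i / 2 ^ m" "i \<le> 2 ^ m"
proof -
  have "y = real 0 / 2 ^ m \<or> y = real (2 ^ m) / 2 ^ m \<or> (\<exists>i<2 ^ m. y = real i / 2 ^ m)"
    using assms unfolding coarse_grid_def by auto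
  then show ?thesis
    using that by (metis le0 less_imp_le order_refl)
qed

lemma full_blocks_eq_cells:
  assumes "1 \<le> b" "b \<le> 2 ^ m" "r < b"
  shows "{block b r q | q. full_block m b r q} =
    {B. card B = b \<and> (\<exists>(u, v)\<in>cells (coarse_grid m b r).
          B = {j. j < 2 ^ m \<and> u \<le> real j / 2 ^ m \<and> real (j + 1) / 2 ^ m \<le> v})}"
proof -
  have idx: "{j. j < 2 ^ m \<and> real i / 2 ^ m \<le> real j / 2 ^ m \<and> real (j + 1) / 2 ^ m \<le> real k / 2 ^ m}
      = {i..<k}" if "k \<le> 2 ^ m" for i k :: nat
    using that by (auto simp: divide_le_cancel simp flip: of_nat_Suc)
  show ?thesis
  proof (intro set_eqI iffI)
    fix B assume "B \<in> {block b r q | q. full_block m b r q}"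
    then obtain q where B: "B = block b r q" and q: "r + (q + 1) * b \<le> 2 ^ m"
      by (auto simp: full_block_def)
    define i k where "i = r + q * b" and "k = r + (q + 1) * b"
    have ik: "k = i + b" "k \<le> 2 ^ m" "i mod b = r"
      using q assms by (auto simp: i_def k_def)
    then have "k mod b = r" by simp
    note ik = ik this
    have "real i / 2 ^ m \<in> coarse_grid m b r" "real k / 2 ^ m \<in> coarse_grid m b r"
      unfolding coarse_grid_iff[OF assms(3)] using ik assms by linarith+
    moreover have "y \<notin> {real i / 2 ^ m<..<real k / 2 ^ m}" if mem: "y \<in> coarse_grid m b r" for y
    proof
      assume y: "y \<in> {real i / 2 ^ m<..<real k / 2 ^ m}"
      obtain n where n: "y = real n / 2 ^ m" "n \<le> 2 ^ m"
        by (rule coarse_gridE[OF mem])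
      have "i < n" "n < k"
        using y n(1) by (auto simp: divide_less_cancel)
      moreover from this have "n mod b = r"
        using mem[unfolded n(1) coarse_grid_iff[OF assms(3)]] ik by linarith
      ultimately have "b dvd n - i" "0 < n - i" "n - i < b"
        using ik mod_eq_dvd_iff_nat[of i n b] by auto
      then show False
        by (auto dest: dvd_imp_le)
    qed
    ultimately have "(real i / 2 ^ m, real k / 2 ^ m) \<in> cells (coarse_grid m b r)"
      using ik assms unfolding cells_def by (auto simp: divide_less_cancel)
    moreover have "B = {i..<k}" "card B = b"
      using ik by (auto simp: B block_def i_def k_def)
    ultimately show "B \<in> {B. card B = b \<and> (\<exists>(u, v)\<in>cells (coarse_grid m b r).
          B = {j. j < 2 ^ m \<and> u \<le> real j / 2 ^ m \<and> real (j + 1) / 2 ^ m \<le> v})}"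
      using idx[OF ik(2), of i] by blast
  next
    fix B assume "B \<in> {B. card B = b \<and> (\<exists>(u, v)\<in>cells (coarse_grid m b r).
          B = {j. j < 2 ^ m \<and> u \<le> real j / 2 ^ m \<and> real (j + 1) / 2 ^ m \<le> v})}"
    then obtain u v where uv: "(u, v) \<in> cells (coarse_grid m b r)" and card: "card B = b"
      and B: "B = {j. j < 2 ^ m \<and> u \<le> real j / 2 ^ m \<and> real (j + 1) / 2 ^ m \<le> v}"
      by auto
    have mem: "u \<in> coarse_grid m b r" "v \<in> coarse_grid m b r"
      and gap: "\<And>y. y \<in> coarse_grid m b r \<Longrightarrow> \<not> (u < y \<and> y < v)"
      using uv by (auto simp: cells_def)
    obtain i where i: "u = real i / 2 ^ m" "i \<le> 2 ^ m" by (rule coarse_gridE[OF mem(1)])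
    obtain k where k: "v = real k / 2 ^ m" "k \<le> 2 ^ m" by (rule coarse_gridE[OF mem(2)])
    have Bik: "B = {i..<k}" using B idx[OF k(2), of i] by (simp add: i k)
    with card assms have ki: "k = i + b" by auto
    have "i mod b = r"
    proof (cases "i = 0 \<and> r \<noteq> 0")
      case True
      have "real r / 2 ^ m \<in> coarse_grid m b r"
        using assms coarse_grid_iff[OF assms(3), of r m] by auto
      then have "\<not> (u < real r / 2 ^ m \<and> real r / 2 ^ m < v)" by (rule gap)
      then show ?thesis
        using True ki assms by (auto simp: i k divide_less_cancel)
    next
      case False
      then show ?thesis
        using mem(1) ki k assms coarse_grid_iff[OF assms(3), of i m] by (auto simp: i)
    qed
    then have "i = r + (i div b) * b" by (metis add.commute div_mult_mod_eq)
    moreover from this have "B = block b r (i div b)" "full_block m b r (i div b)"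
      using Bik ki k by (auto simp: block_def full_block_def)
    ultimately show "B \<in> {block b r q | q. full_block m b r q}" by blast
  qed
qed

definition G :: "real \<Rightarrow> nat \<Rightarrow> nat \<Rightarrow> nat \<Rightarrow> nat \<Rightarrow> real \<Rightarrow> (nat \<Rightarrow> nat \<Rightarrow> real) \<Rightarrow> real" where
  "G p m b r q a \<theta> = 1 / real b * cg_error p (block b r q) (\<lambda>j. Z p m j a \<theta>)"

definition holder_bound :: "real \<Rightarrow> (real \<Rightarrow> real) \<Rightarrow> real \<Rightarrow> bool" where
  "holder_bound p x H \<longleftrightarrow> (\<forall>s\<in>{0..1}. \<forall>t\<in>{0..1}. \<bar>x t - x s\<bar> \<le> H * \<bar>t - s\<bar> powr (1 / p))"

end

theory Submission
  imports Defs "HOL-Probability.Distribution_Functions"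
begin

text \<open>
  At level \<open>m\<close> the normalised variable \<open>Z\<close> is \<open>2 powr (m / p)\<close> times a dyadic increment of \<open>x\<close>, so
  the block bound says that over \<open>M\<close> consecutive full blocks the coarse and the fine
  \<open>p\<close>-variation differ by at most \<open>C h M powr (1 - \<eta>)\<close>, where \<open>h = b / 2 ^ m\<close>. As \<open>M \<le> 1 / h\<close>,
  this is at most \<open>C h powr \<eta>\<close>; the two incomplete blocks at \<open>0\<close> and at the stopping time
  cost at most \<open>H powr p * h\<close> each by Hoelder continuity. This bounds the coarse-graining error.

  A general grid with mesh \<open>l\<close> and shift \<open>s\<close> is the limit, as \<open>m \<rightarrow> \<infinity>\<close>, of the coarse dyadic grids
  with \<open>b = \<lfloor>l 2 ^ m\<rfloor>\<close> and \<open>r = \<lfloor>s 2 ^ m\<rfloor>\<close>. Since \<open>x\<close> is continuous and the bound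
  \<open>C h powr \<eta> + 2 H powr p * h\<close> does not depend on \<open>m\<close>, it survives the limit with \<open>h = l\<close>, uniformly in \<open>s\<close> and
  in the time. Hence \<open>x\<close> is rough as soon as the dyadic variations converge at each time, which
  is weak convergence to an atomless measure.
\<close>

subsection \<open>Variation along shifted grids\<close>

lemma cells_insert_top:
  assumes "y \<in> P" "\<And>u. u \<in> P \<Longrightarrow> u \<le> y" "y < z"
  shows "cells (insert z P) = insert (y, z) (cells P)"
proof -
  have "(u, v) \<in> cells (insert z P) \<longleftrightarrow> (u, v) \<in> insert (y, z) (cells P)" for u v
  proof
    assume uv: "(u, v) \<in> cells (insert z P)"
    have u: "u \<in> P" "u \<le> y"
      using uv assms unfolding cells_def by force+
    show "(u, v) \<in> insert (y, z) (cells P)"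
    proof (cases "v = z")
      case True
      then have "\<not> u < y"
        using uv assms unfolding cells_def by auto
      with u True show ?thesis by simp
    next
      case False
      with uv u show ?thesis
        unfolding cells_def by auto
    qed
  next
    assume "(u, v) \<in> insert (y, z) (cells P)"
    then show "(u, v) \<in> cells (insert z P)"
      using assms unfolding cells_def by force
  qed
  then show ?thesis
    by auto
qed

text \<open>Clipping a lattice to the unit interval repeats the endpoints. Repeated values span no
  cell, and \<open>f (u, u) = 0\<close> makes their terms vanish, so \<open>g\<close> need only be
  monotone, not injective.\<close>

lemma sum_cells_mono_image:
  fixes g :: "nat \<Rightarrow> real"
  assumes "mono g" "\<And>u. f (u, u) = 0"
  shows "sum f (cells (g ` {..N})) = (\<Sum>k<N. f (g k, g (Suc k)))"
proof (induction N)
  case 0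
  have "cells {g 0} = {}"
    by (auto simp: cells_def)
  then show ?case
    by simp
next
  case (Suc N)
  have image: "g ` {..Suc N} = insert (g (Suc N)) (g ` {..N})"
    by (simp add: atMost_Suc)
  have le: "u \<le> g N" if "u \<in> g ` {..N}" for u
    using that monoD[OF assms(1)] by auto
  \<comment> \<open>A repeated value leaves the point set unchanged; a new value lies above all
    earlier ones and adds exactly one cell.\<close>
  show ?case
  proof (cases "g N = g (Suc N)")
    case True
    then have "g (Suc N) \<in> g ` {..N}"
      by (intro image_eqI[of _ _ N]) auto
    then have "g ` {..Suc N} = g ` {..N}"
      unfolding image by (rule insert_absorb)
    then show ?thesis
      using Suc True assms(2) by simp
  next
    case False
    then have less: "g N < g (Suc N)"
      using monoD[OF assms(1), of N "Suc N"] by simp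
    have "cells (g ` {..Suc N}) = insert (g N, g (Suc N)) (cells (g ` {..N}))"
      unfolding image using le less by (intro cells_insert_top) auto
    moreover have "finite (cells (g ` {..N}))"
      by (rule finite_subset[of _ "g ` {..N} \<times> g ` {..N}"]) (auto simp: cells_def)
    moreover have "(g N, g (Suc N)) \<notin> cells (g ` {..N})"
      using le less by (force simp: cells_def)
    ultimately show ?thesis
      using Suc by (simp add: add.commute)
  qed
qed

text \<open>Clamping the argument to the interval from 0 to \<open>t\<close> merges two operations:
  stopping at \<open>t\<close> and cutting the grid off at 0. Variations then become sums over
  unclipped arithmetic progressions.\<close>

definition stopped :: "(real \<Rightarrow> real) \<Rightarrow> real \<Rightarrow> real \<Rightarrow> real" where
  "stopped x t u = x (max 0 (min t u))"

lemma stopped_eq: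
  "0 \<le> u \<Longrightarrow> u \<le> t \<Longrightarrow> stopped x t u = x u"
  "0 \<le> t \<Longrightarrow> t \<le> u \<Longrightarrow> stopped x t u = x t"
  "0 \<le> t \<Longrightarrow> u \<le> 0 \<Longrightarrow> stopped x t u = x 0"
  by (simp_all add: stopped_def min.coboundedI2)

text \<open>The term \<open>k = 0\<close> is the incomplete cell from 0 to \<open>s\<close>: its
  left point \<open>s - l\<close> is negative and is clamped to 0. The number of terms only has to
  be large enough, so one \<open>N\<close> can serve all nearby meshes and shifts, which is what
  makes limits of grids accessible.\<close>

lemma pvariation_shifted_grid:
  assumes t: "0 \<le> t" "t \<le> 1" and s: "0 \<le> s" "s < l" and N: "t \<le> s + real N * l"
  shows "pvariation p (shifted_grid l s) x t =
    (\<Sum>k<Suc N. \<bar>stopped x t (s + real k * l) - stopped x t (s + (real k - 1) * l)\<bar> powr p)"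
proof -
  have l: "0 < l" using s by simp
  obtain N0 :: nat where N0: "1 / l < real N0"
    using reals_Archimedean2 by blast
  \<comment> \<open>The grid is exhausted only once the progression has passed 1; the terms beyond
    \<open>N\<close> are discarded at the end.\<close>
  define N' where "N' = max N N0"
  have "1 \<le> real N0 * l"
    using N0 l by (simp add: field_simps)
  also have "\<dots> \<le> real N' * l"
    using l by (simp add: N'_def)
  finally have N': "1 \<le> s + real N' * l"
    using s by simp
  \<comment> \<open>The index is shifted by one so that \<open>g 0\<close> is the clamped point
    \<open>s - l\<close>, that is, the left end 0.\<close>
  define g where "g k = max 0 (min 1 (s + (real k - 1) * l))" for k :: nat
  have mono: "mono g"
    unfolding mono_def g_def using l
    by (intro allI impI max.mono min.mono add_mono mult_right_mono) auto
  have "shifted_grid l s = g ` {..Suc N'}"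
  proof (intro equalityI subsetI)
    fix y assume "y \<in> shifted_grid l s"
    then consider "y = 0" | "y = 1" | k :: int where "y = s + of_int k * l" "0 < y" "y < 1"
      unfolding shifted_grid_def by auto
    then show "y \<in> g ` {..Suc N'}"
    proof cases
      case 1
      then have "y = g 0" using s by (simp add: g_def)
      then show ?thesis by blast
    next
      case 2
      then have "y = g (Suc N')" using N' by (simp add: g_def)
      then show ?thesis by blast
    next
      case 3
      have "0 \<le> k"
      proof (rule ccontr)
        assume "\<not> 0 \<le> k"
        then have "of_int k * l \<le> (- 1) * l"
          using l by (intro mult_right_mono) linarith+
        then show False using 3 s by simp
      qed
      moreover have "k \<le> int N'"
      proof (rule ccontr)
        assume "\<not> k \<le> int N'"
        then have "real N' * l \<le> of_int k * l"
          using l by (intro mult_right_mono) linarith+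
        then show False using 3 N' by simp
      qed
      moreover have "y = g (Suc (nat k))"
        using 3 \<open>0 \<le> k\<close> by (simp add: g_def)
      ultimately show ?thesis
        by (intro image_eqI[where x = "Suc (nat k)"]) auto
    qed
  next
    fix y assume "y \<in> g ` {..Suc N'}"
    then obtain k where k: "y = g k" by blast
    show "y \<in> shifted_grid l s"
    proof (cases "y = 0 \<or> y = 1")
      case True
      then show ?thesis by (auto simp: shifted_grid_def)
    next
      case False
      then have "y = s + of_int (int k - 1) * l" "0 < y" "y < 1"
        using k by (auto simp: g_def max_def min_def split: if_splits)
      then show ?thesis
        unfolding shifted_grid_def by blast
    qed
  qed
  then have "pvariation p (shifted_grid l s) x t =
      (\<Sum>k<Suc N'. \<bar>x (min (g (Suc k)) t) - x (min (g k) t)\<bar> powr p)"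
    unfolding pvariation_def by (simp only:) (subst sum_cells_mono_image[OF mono]; simp)
  also have "\<dots> = (\<Sum>k<Suc N'. \<bar>stopped x t (s + real k * l) - stopped x t (s + (real k - 1) * l)\<bar> powr p)"
  proof -
    have "x (min (g k) t) = stopped x t (s + (real k - 1) * l)" for k
      using t by (simp add: g_def stopped_def max_def min_def)
    from this this[of "Suc _"] show ?thesis
      by simp
  qed
  \<comment> \<open>For \<open>k > N\<close> both points lie at or beyond \<open>t\<close>, where
    the stopped path is constant.\<close>
  also have "\<dots> = (\<Sum>k<Suc N. \<bar>stopped x t (s + real k * l) - stopped x t (s + (real k - 1) * l)\<bar> powr p)"
  proof (rule sum.mono_neutral_right)
    show "{..<Suc N} \<subseteq> {..<Suc N'}"
      by (auto simp: N'_def)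
    show "\<forall>k\<in>{..<Suc N'} - {..<Suc N}.
        \<bar>stopped x t (s + real k * l) - stopped x t (s + (real k - 1) * l)\<bar> powr p = 0"
    proof
      fix k assume k: "k \<in> {..<Suc N'} - {..<Suc N}"
      have "real N * l \<le> (real k - 1) * l" "(real k - 1) * l \<le> real k * l"
        using l k by (auto intro!: mult_right_mono)
      then show "\<bar>stopped x t (s + real k * l) - stopped x t (s + (real k - 1) * l)\<bar> powr p = 0"
        using t N by (simp add: stopped_eq(2))
    qed
  qed simp
  finally show ?thesis .
qed

text \<open>Puts the coarse dyadic grids within reach of the sum formula above and of the passage to
  general meshes and shifts below.\<close>

lemma coarse_grid_eq_shifted_grid:
  assumes "r < b"
  shows "coarse_grid m b r = shifted_grid (real b / 2 ^ m) (real r / 2 ^ m)"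
proof -
  have "(\<exists>j::nat. y = real j / 2 ^ m \<and> 1 \<le> j \<and> j < 2 ^ m \<and> [j = r] (mod b)) \<longleftrightarrow>
      (\<exists>k::int. y = real r / 2 ^ m + of_int k * (real b / 2 ^ m) \<and>
        0 < real r / 2 ^ m + of_int k * (real b / 2 ^ m) \<and>
        real r / 2 ^ m + of_int k * (real b / 2 ^ m) < 1)" (is "?P \<longleftrightarrow> ?Q") for y :: real
  proof
    assume ?P
    then obtain j :: nat where j: "y = real j / 2 ^ m" "1 \<le> j" "j < 2 ^ m" "[j = r] (mod b)"
      by blast
    have "j = r + (j div b) * b"
      using j(4) assms by (metis cong_def mod_less add.commute div_mult_mod_eq)
    then have "real j = real r + of_int (int (j div b)) * real b"
      by (metis of_int_of_nat_eq of_nat_add of_nat_mult)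
    then have "y = real r / 2 ^ m + of_int (int (j div b)) * (real b / 2 ^ m)"
      using j(1) by (simp add: add_divide_distrib)
    moreover have "0 < y" "y < 1"
      using j by (auto simp: divide_less_eq)
    ultimately show ?Q
      by blast
  next
    assume ?Q
    then obtain k :: int where k: "y = real r / 2 ^ m + of_int k * (real b / 2 ^ m)" "0 < y" "y < 1"
      by blast
    have y: "y = of_int (int r + k * int b) / 2 ^ m"
      using k(1) by (simp add: add_divide_distrib)
    then have "of_int (int r + k * int b) = y * 2 ^ m"
      by simp
    moreover have "0 < y * 2 ^ m" "y * 2 ^ m < 1 * 2 ^ m"
      using k(2,3) by simp_all
    ultimately have "(0::real) < of_int (int r + k * int b)" "of_int (int r + k * int b) < (2::real) ^ m"
      by linarith+
    then have pos: "0 < int r + k * int b" "int r + k * int b < 2 ^ m"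
      by (metis of_int_0_less_iff, metis of_int_less_iff of_int_numeral of_int_power)
    define j where "j = nat (int r + k * int b)"
    have j: "int j = int r + k * int b"
      using pos(1) by (simp add: j_def)
    have "y = real j / 2 ^ m"
      using y unfolding j[symmetric] by simp
    moreover have "1 \<le> j"
      using j pos(1) by linarith
    moreover have "[int j = int r] (mod int b)"
      unfolding j by (simp add: cong_def)
    then have "[j = r] (mod b)"
      by (simp only: cong_int_iff)
    moreover have "int j < int (2 ^ m)"
      using pos(2) j by simp
    then have "j < 2 ^ m"
      by (simp only: of_nat_less_iff)
    ultimately show ?P
      by blast
  qed
  then show ?thesis
    unfolding coarse_grid_def shifted_grid_def by (simp only:)
qed

lemma dyadic_grid_eq_shifted_grid: "dyadic_grid m = shifted_grid (1 / 2 ^ m) 0"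
proof -
  have "dyadic_grid m = coarse_grid m 1 0"
    unfolding coarse_grid_def dyadic_grid_def cong_def
  proof (intro equalityI subsetI)
    fix y assume "y \<in> {real j / 2 ^ m |j. j \<le> 2 ^ m}"
    then obtain j :: nat where j: "y = real j / 2 ^ m" "j \<le> 2 ^ m" by blast
    then have "j = 0 \<or> j = 2 ^ m \<or> 1 \<le> j \<and> j < 2 ^ m" by auto
    then show "y \<in> {0, 1} \<union> {real j / 2 ^ m |j. 1 \<le> j \<and> j < 2 ^ m \<and> j mod 1 = 0 mod 1}"
      using j by auto
  next
    fix y assume "y \<in> {0, 1} \<union> {real j / 2 ^ m |j. 1 \<le> j \<and> j < 2 ^ m \<and> j mod 1 = 0 mod 1}"
    moreover have "(0::real) = real 0 / 2 ^ m" "(1::real) = real (2 ^ m) / 2 ^ m" by auto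
    ultimately show "y \<in> {real j / 2 ^ m |j. j \<le> 2 ^ m}"
      by (smt (verit) Un_iff insert_iff le0 less_imp_le mem_Collect_eq order_refl singletonD)
  qed
  then show ?thesis
    by (simp add: coarse_grid_eq_shifted_grid)
qed

section \<open>Hoelder control of stopped increments\<close>

lemma holder_bound_nonneg:
  assumes "holder_bound p x H"
  shows "0 \<le> H"
proof -
  have "\<bar>x 1 - x 0\<bar> \<le> H * \<bar>1 - 0\<bar> powr (1 / p)"
    using assms unfolding holder_bound_def by (metis atLeastAtMost_iff order_refl zero_le_one)
  then show ?thesis by simp
qed

text \<open>Clamping is 1-Lipschitz, and the \<open>p\<close>-th power turns the exponent
  \<open>1 / p\<close> into a bound linear in the distance. Linear bounds add up over adjacent
  cells.\<close>

lemma stopped_powr_le: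
  assumes "holder_bound p x H" "0 < p" "0 \<le> t" "t \<le> 1"
  shows "\<bar>stopped x t u - stopped x t v\<bar> powr p \<le> H powr p * \<bar>u - v\<bar>"
proof -
  define u' v' where "u' = max 0 (min t u)" and "v' = max 0 (min t v)"
  have "\<bar>x u' - x v'\<bar> \<le> H * \<bar>u' - v'\<bar> powr (1 / p)"
    using assms unfolding holder_bound_def u'_def v'_def by auto
  also have "\<dots> \<le> H * \<bar>u - v\<bar> powr (1 / p)"
    using assms holder_bound_nonneg[OF assms(1)]
    by (intro mult_left_mono powr_mono2) (auto simp: u'_def v'_def)
  finally have "\<bar>x u' - x v'\<bar> powr p \<le> (H * \<bar>u - v\<bar> powr (1 / p)) powr p"
    using assms by (intro powr_mono2) auto
  also have "\<dots> = H powr p * \<bar>u - v\<bar>"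
    using assms holder_bound_nonneg[OF assms(1)] by (simp add: powr_mult powr_powr)
  finally show ?thesis
    by (simp add: stopped_def u'_def v'_def)
qed

subsection \<open>Faber--Schauder expansion of the increments\<close>

text \<open>The halves of the level-\<open>l\<close> interval with index \<open>kappa l m j\<close>
  have indices \<open>2 * kappa l m j\<close> and \<open>2 * kappa l m j + 1\<close> at level
  \<open>l + 1\<close>. The quotient is the index of the half containing the fine interval, so its
  last binary digit decides the sign.\<close>

lemma eps_eq:
  assumes "l < m"
  shows "eps l m j = (if even (j div 2 ^ (m - l - 1)) then 1 else - 1)"
proof -
  define n where "n = m - l - 1"
  define w where "w = j div 2 ^ n"
  have ml: "m - l = Suc n" "m = l + Suc n"
    using assms by (auto simp: n_def)
  have \<kappa>: "kappa l m j = w div 2"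
    unfolding kappa_def ml(1) w_def power_Suc2 by (rule div_mult2_eq)
  have pow: "(2::real) ^ m = 2 ^ l * (2 * 2 ^ n)"
    unfolding ml(2) by (simp add: power_add)
  have "real (kappa l m j) / 2 ^ l \<le> real j / 2 ^ m"
  proof -
    have "kappa l m j * 2 ^ (m - l) \<le> j"
      unfolding kappa_def by (rule div_times_less_eq_dividend)
    then have "real (kappa l m j * 2 ^ (m - l)) \<le> real j"
      by (simp only: of_nat_le_iff)
    then have "real (kappa l m j) * (2 * 2 ^ n) \<le> real j"
      unfolding ml(1) by simp
    then show ?thesis
      unfolding pow by (simp add: field_simps)
  qed
  moreover have "real (j + 1) / 2 ^ m \<le> (real (kappa l m j) + 1 / 2) / 2 ^ l \<longleftrightarrow> even w"
  proof -
    have "real (j + 1) / 2 ^ m \<le> (real (kappa l m j) + 1 / 2) / 2 ^ l \<longleftrightarrow>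
        real (j + 1) \<le> (2 * real (kappa l m j) + 1) * 2 ^ n"
    proof -
      have eq: "(real (kappa l m j) + 1 / 2) / 2 ^ l = (2 * real (kappa l m j) + 1) * 2 ^ n / 2 ^ m"
        unfolding pow by (simp add: field_simps)
      show ?thesis
        unfolding eq by (simp add: divide_le_cancel)
    qed
    also have "\<dots> \<longleftrightarrow> real (j + 1) \<le> real ((2 * kappa l m j + 1) * 2 ^ n)"
      by (simp add: algebra_simps)
    also have "\<dots> \<longleftrightarrow> j < (2 * kappa l m j + 1) * 2 ^ n"
      unfolding of_nat_le_iff by linarith
    also have "\<dots> \<longleftrightarrow> w < 2 * (w div 2) + 1"
      unfolding \<kappa> w_def by (simp add: div_less_iff_less_mult)
    also have "\<dots> \<longleftrightarrow> even w"
      by presburger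
    finally show ?thesis .
  qed
  moreover have "real j / 2 ^ m < real (j + 1) / 2 ^ m"
    by (simp add: divide_strict_right_mono)
  ultimately show ?thesis
    unfolding eps_def greaterThanLessThan_subseteq_atLeastAtMost_iff w_def n_def
    by (simp only: simp_thms)
qed

text \<open>Both sides are the slope of the level-\<open>m\<close> piecewise linear interpolant of
  \<open>x\<close> on one dyadic interval. Refining by one level changes the slope of the parent
  interval by \<open>2 powr (m / 2) * \<theta> m k\<close>, with sign plus on the left child and
  minus on the right child.\<close>

lemma faber_schauder_slope:
  assumes "\<And>l k. k < 2 ^ l \<Longrightarrow> \<theta> l k = fs_coeff x l k" "j < 2 ^ m"
  shows "x 1 - x 0 + (\<Sum>l<m. 2 powr (real l / 2) * \<theta> l (kappa l m j) * eps l m j) =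
    2 ^ m * (x (real (j + 1) / 2 ^ m) - x (real j / 2 ^ m))"
  using assms(2)
proof (induction m arbitrary: j)
  case 0
  then show ?case by simp
next
  case (Suc m)
  define k where "k = j div 2"
  have k: "k < 2 ^ m"
    using Suc.prems by (simp add: k_def less_mult_imp_div_less mult.commute)
  \<comment> \<open>The interval \<open>j\<close> and its parent \<open>k\<close> have the same
    ancestors and signs at all levels below \<open>m\<close>; only the term \<open>l = m\<close> is
    new.\<close>
  have "2 powr (real l / 2) * \<theta> l (kappa l (Suc m) j) * eps l (Suc m) j =
      2 powr (real l / 2) * \<theta> l (kappa l m k) * eps l m k" if "l < m" for l
  proof -
    have eq: "j div 2 ^ Suc n = k div 2 ^ n" for n
      unfolding k_def by (simp add: div_mult2_eq)
    have "Suc m - l = Suc (m - l)" "Suc m - l - 1 = Suc (m - l - 1)"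
      using that by auto
    then show ?thesis
      using that unfolding kappa_def by (simp only: eps_eq less_SucI eq)
  qed
  then have "(\<Sum>l<m. 2 powr (real l / 2) * \<theta> l (kappa l (Suc m) j) * eps l (Suc m) j) =
      (\<Sum>l<m. 2 powr (real l / 2) * \<theta> l (kappa l m k) * eps l m k)"
    by (intro sum.cong refl) simp
  then have "x 1 - x 0 + (\<Sum>l<Suc m. 2 powr (real l / 2) * \<theta> l (kappa l (Suc m) j) * eps l (Suc m) j) =
      x 1 - x 0 + (\<Sum>l<m. 2 powr (real l / 2) * \<theta> l (kappa l m k) * eps l m k) +
      2 powr (real m / 2) * fs_coeff x m k * (if even j then 1 else - 1)"
    using assms(1)[OF k] by (simp add: kappa_def[of m] eps_eq[of m] k_def)
  also have "2 powr (real m / 2) * fs_coeff x m k =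
      2 ^ m * (2 * x (real (2 * k + 1) / 2 ^ (m + 1)) - x (real k / 2 ^ m) - x (real (k + 1) / 2 ^ m))"
  proof -
    have "2 powr (real m / 2) * 2 powr (real m / 2) = (2::real) ^ m"
      unfolding powr_add[symmetric] by (simp add: powr_realpow)
    then show ?thesis
      unfolding fs_coeff_def mult.assoc[symmetric] by (simp only:)
  qed
  also have "x 1 - x 0 + (\<Sum>l<m. 2 powr (real l / 2) * \<theta> l (kappa l m k) * eps l m k) =
      2 ^ m * (x (real (k + 1) / 2 ^ m) - x (real k / 2 ^ m))"
    by (rule Suc.IH[OF k])
  also have "2 ^ m * (x (real (k + 1) / 2 ^ m) - x (real k / 2 ^ m)) +
      2 ^ m * (2 * x (real (2 * k + 1) / 2 ^ (m + 1)) - x (real k / 2 ^ m) - x (real (k + 1) / 2 ^ m)) *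
        (if even j then 1 else - 1) =
      2 ^ Suc m * (x (real (j + 1) / 2 ^ Suc m) - x (real j / 2 ^ Suc m))"
  proof (cases "even j")
    case True
    then have "j = 2 * k" by (simp add: k_def)
    then have "real j / 2 ^ Suc m = real k / 2 ^ m" "j + 1 = 2 * k + 1"
      by simp_all
    then show ?thesis
      using True by (simp add: algebra_simps)
  next
    case False
    then have "j = 2 * k + 1" by (simp add: k_def)
    then have "real (j + 1) / 2 ^ Suc m = real (k + 1) / 2 ^ m" "j = 2 * k + 1"
      by (simp_all add: field_simps)
    then show ?thesis
      using False by (simp add: algebra_simps)
  qed
  finally show ?case .
qed

text \<open>The exponent is \<open>- m + m / p\<close>: the first part turns the slope into an
  increment, the second is the critical normalisation.\<close>

lemma Z_eq:
  assumes "\<And>l k. k < 2 ^ l \<Longrightarrow> \<theta> l k = fs_coeff x l k" "j < 2 ^ m"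
  shows "Z p m j (x 1 - x 0) \<theta> = 2 powr (real m / p) * (x (real (j + 1) / 2 ^ m) - x (real j / 2 ^ m))"
proof -
  have "2 powr (- real m * (1 - 1 / p)) * 2 ^ m = 2 powr (real m / p)"
  proof -
    have "2 powr (- real m * (1 - 1 / p)) * 2 ^ m = 2 powr (- real m * (1 - 1 / p) + real m)"
      unfolding powr_add by (simp add: powr_realpow)
    also have "- real m * (1 - 1 / p) + real m = real m / p"
      by (simp add: algebra_simps)
    finally show ?thesis .
  qed
  moreover have "x 1 - x 0 + (\<Sum>l<m. 2 powr (real l / 2) * \<theta> l (kappa l m j) * eps l m j) =
      2 ^ m * (x (real (j + 1) / 2 ^ m) - x (real j / 2 ^ m))"
    using assms by (rule faber_schauder_slope)
  ultimately show ?thesis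
    unfolding Z_def by (simp only: mult.assoc[symmetric])
qed

text \<open>The increments telescope over the block, and the common factor
  \<open>2 powr (m / p)\<close> becomes \<open>2 ^ m\<close> after the \<open>p\<close>-th power.
  Fullness of the block keeps every index below \<open>2 ^ m\<close>.\<close>

lemma G_eq:
  assumes "\<And>l k. k < 2 ^ l \<Longrightarrow> \<theta> l k = fs_coeff x l k" "full_block m b r q" "0 < p"
  shows "G p m b r q (x 1 - x 0) \<theta> = 2 ^ m / real b *
    (\<bar>x (real (r + (q + 1) * b) / 2 ^ m) - x (real (r + q * b) / 2 ^ m)\<bar> powr p -
      (\<Sum>j\<in>block b r q. \<bar>x (real (j + 1) / 2 ^ m) - x (real j / 2 ^ m)\<bar> powr p))"
proof -
  define c where "c = 2 powr (real m / p)"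
  define y where "y j = x (real j / 2 ^ m)" for j
  have Z: "Z p m j (x 1 - x 0) \<theta> = c * (y (Suc j) - y j)" if "j \<in> block b r q" for j
    using Z_eq[OF assms(1), of j m p] that assms(2) by (simp add: block_def full_block_def c_def y_def)
  have c: "0 < c" "c powr p = 2 ^ m"
    using assms(3) by (auto simp: c_def powr_powr powr_realpow)
  have "(\<Sum>j\<in>block b r q. Z p m j (x 1 - x 0) \<theta>) = (\<Sum>j\<in>block b r q. c * (y (Suc j) - y j))"
    by (intro sum.cong refl Z)
  also have "\<dots> = c * (\<Sum>j = r + q * b..<r + (q + 1) * b. y (Suc j) - y j)"
    unfolding block_def by (rule sum_distrib_left[symmetric])
  also have "(\<Sum>j = r + q * b..<r + (q + 1) * b. y (Suc j) - y j) = y (r + (q + 1) * b) - y (r + q * b)"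
    by (rule sum_Suc_diff') simp
  finally have 1: "\<bar>\<Sum>j\<in>block b r q. Z p m j (x 1 - x 0) \<theta>\<bar> powr p =
      2 ^ m * \<bar>y (r + (q + 1) * b) - y (r + q * b)\<bar> powr p"
    using c by (simp add: abs_mult powr_mult)
  have "(\<Sum>j\<in>block b r q. \<bar>Z p m j (x 1 - x 0) \<theta>\<bar> powr p) =
      (\<Sum>j\<in>block b r q. 2 ^ m * \<bar>y (Suc j) - y j\<bar> powr p)"
    using c by (intro sum.cong refl) (simp add: Z abs_mult powr_mult)
  then have 2: "(\<Sum>j\<in>block b r q. \<bar>Z p m j (x 1 - x 0) \<theta>\<bar> powr p) =
      2 ^ m * (\<Sum>j\<in>block b r q. \<bar>y (j + 1) - y j\<bar> powr p)"
    by (simp add: sum_distrib_left)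
  show ?thesis
    unfolding G_def cg_error_def 1 2 y_def[symmetric] by (simp add: right_diff_distrib)
qed

subsection \<open>Coarse-graining error\<close>

text \<open>With shift 0 the term \<open>k = 0\<close> compares two points clamped to 0 and drops
  out.\<close>

lemma pvariation_dyadic_grid:
  assumes "0 \<le> t" "t \<le> 1" "t * 2 ^ m \<le> real K"
  shows "pvariation p (dyadic_grid m) x t =
    (\<Sum>j<K. \<bar>stopped x t (real (j + 1) / 2 ^ m) - stopped x t (real j / 2 ^ m)\<bar> powr p)"
  using assms unfolding dyadic_grid_eq_shifted_grid
  by (subst pvariation_shifted_grid[where N = K])
    (simp_all add: sum.lessThan_Suc_shift stopped_eq field_simps del: sum.lessThan_Suc)

text \<open>The full blocks before \<open>t\<close> are covered by \<open>E\<close>. What remains is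
  the piece before \<open>r\<close> and the block containing \<open>t\<close>. On each of these the
  coarse term and the fine sum both lie between 0 and \<open>H powr p * (b / 2 ^ m)\<close>, so they
  differ by at most that amount; hence the factor 2.\<close>

lemma coarse_pvariation_diff_le:
  assumes p: "0 < p" and H: "holder_bound p x H" and t: "0 \<le> t" "t \<le> 1" and b: "r < b"
    and E: "0 \<le> E" "\<And>M. 1 \<le> M \<Longrightarrow> r + M * b \<le> 2 ^ m \<Longrightarrow>
      \<bar>\<Sum>q<M. \<bar>x (real (r + (q + 1) * b) / 2 ^ m) - x (real (r + q * b) / 2 ^ m)\<bar> powr p -
        (\<Sum>j\<in>block b r q. \<bar>x (real (j + 1) / 2 ^ m) - x (real j / 2 ^ m)\<bar> powr p)\<bar> \<le> E"
  shows "\<bar>pvariation p (coarse_grid m b r) x t - pvariation p (dyadic_grid m) x t\<bar>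
    \<le> E + 2 * H powr p * (real b / 2 ^ m)"
proof -
  define h where "h = H powr p / 2 ^ m"
  have h: "0 \<le> h" by (simp add: h_def)
  define y where "y j = stopped x t (real j / 2 ^ m)" for j
  have le: "\<bar>y i - y j\<bar> powr p \<le> h * real k" if "\<bar>real i - real j\<bar> \<le> real k" for i j k
  proof -
    have "\<bar>y i - y j\<bar> powr p \<le> H powr p * \<bar>real i / 2 ^ m - real j / 2 ^ m\<bar>"
      unfolding y_def by (rule stopped_powr_le[OF H p t])
    also have "\<dots> = h * \<bar>real i - real j\<bar>"
      by (simp add: h_def flip: diff_divide_distrib)
    also have "\<dots> \<le> h * real k"
      using that h by (intro mult_left_mono)
    finally show ?thesis .
  qed
  have sum_le: "(\<Sum>j\<in>{i..<i + k}. \<bar>y (Suc j) - y j\<bar> powr p) \<le> h * real k" for i k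
  proof -
    have "(\<Sum>j\<in>{i..<i + k}. \<bar>y (Suc j) - y j\<bar> powr p) \<le> real (card {i..<i + k}) * (h * real 1)"
      by (intro sum_bounded_above le) simp
    then show ?thesis by (simp add: mult.commute)
  qed
  have hb: "h * real k \<le> h * real b" if "k \<le> b" for k
    using that h by (intro mult_left_mono) auto
  have fine: "pvariation p (dyadic_grid m) x t = (\<Sum>j<K. \<bar>y (Suc j) - y j\<bar> powr p)"
    if "t * 2 ^ m \<le> real K" for K
    using pvariation_dyadic_grid[OF t that] by (simp add: y_def)
  have coarse: "pvariation p (coarse_grid m b r) x t =
      \<bar>y r - y 0\<bar> powr p + (\<Sum>q<K. \<bar>y (r + (q + 1) * b) - y (r + q * b)\<bar> powr p)"
    if "t * 2 ^ m \<le> real (r + K * b)" for K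
  proof -
    have 0: "stopped x t (real r / 2 ^ m - real b / 2 ^ m) = y 0"
      using b t by (simp add: y_def stopped_eq(3) divide_right_mono)
    have q: "real r / 2 ^ m + real q * (real b / 2 ^ m) = real (r + q * b) / 2 ^ m" for q
      by (simp add: add_divide_distrib)
    have "pvariation p (coarse_grid m b r) x t =
        (\<Sum>k<Suc K. \<bar>stopped x t (real r / 2 ^ m + real k * (real b / 2 ^ m)) -
          stopped x t (real r / 2 ^ m + (real k - 1) * (real b / 2 ^ m))\<bar> powr p)"
      unfolding coarse_grid_eq_shifted_grid[OF b]
      using that t b by (intro pvariation_shifted_grid) (auto simp: field_simps)
    also have "\<dots> = \<bar>y r - y 0\<bar> powr p + (\<Sum>k<K. \<bar>stopped x t (real r / 2 ^ m + real (Suc k) * (real b / 2 ^ m)) -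
          stopped x t (real r / 2 ^ m + real k * (real b / 2 ^ m))\<bar> powr p)"
      unfolding sum.lessThan_Suc_shift by (simp add: 0 y_def)
    finally show ?thesis
      unfolding q y_def by simp
  qed
  have bound: "E + 2 * H powr p * (real b / 2 ^ m) = E + 2 * (h * real b)"
    by (simp add: h_def)
  show ?thesis
  \<comment> \<open>If the path stops by \<open>r\<close>, there is only the initial incomplete
    piece.\<close>
  proof (cases "t * 2 ^ m \<le> real r")
    case True
    have "pvariation p (coarse_grid m b r) x t = \<bar>y r - y 0\<bar> powr p"
      using coarse[of 0] True by simp
    moreover have "pvariation p (dyadic_grid m) x t = (\<Sum>j\<in>{0..<0 + r}. \<bar>y (Suc j) - y j\<bar> powr p)"
      using fine[OF True] by (simp add: atLeast0LessThan)
    moreover have "0 \<le> (\<Sum>j\<in>{0..<0 + r}. \<bar>y (Suc j) - y j\<bar> powr p)"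
      by (intro sum_nonneg) simp
    moreover have "\<bar>y r - y 0\<bar> powr p \<le> h * real r"
      by (rule le) simp
    moreover have "h * real r \<le> h * real b" "0 \<le> h * real b"
      using b h by (auto intro!: mult_left_mono)
    ultimately show ?thesis
      unfolding bound using sum_le[of 0 r] E(1) powr_ge_zero[of "\<bar>y r - y 0\<bar>" p] by linarith
  next
    case False
    then have rt: "real r < t * 2 ^ m" by simp
    \<comment> \<open>\<open>M\<close> counts the full blocks that end by time \<open>t\<close>; on
      them stopping changes nothing. The next block, from \<open>i\<close> to \<open>i + b\<close>,
      contains \<open>t\<close>.\<close>
    define M where "M = nat \<lfloor>(t * 2 ^ m - real r) / real b\<rfloor>"
    have "real M \<le> (t * 2 ^ m - real r) / real b" "(t * 2 ^ m - real r) / real b < real M + 1"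
      unfolding M_def using rt b by (auto simp: le_floor_iff)
    then have M: "real (r + M * b) \<le> t * 2 ^ m" "t * 2 ^ m \<le> real (r + Suc M * b)"
      using b by (auto simp: field_simps)
    have "real (r + M * b) \<le> 1 * 2 ^ m"
      using M(1) t by (meson mult_right_mono order_trans zero_le_numeral zero_le_power)
    then have Mm: "r + M * b \<le> 2 ^ m"
      by (metis mult_1 of_nat_le_iff of_nat_numeral of_nat_power)
    define i where "i = r + M * b"
    have y: "y j = x (real j / 2 ^ m)" if "j \<le> i" for j
    proof -
      have "real j \<le> t * 2 ^ m"
        using that M(1) by (simp only: i_def flip: of_nat_le_iff[where ?'a = real])
      then show ?thesis
        by (simp add: y_def stopped_eq(1) field_simps)
    qed
    define F where "F = (\<Sum>q<M. \<bar>y (r + (q + 1) * b) - y (r + q * b)\<bar> powr p - (\<Sum>j\<in>block b r q. \<bar>y (Suc j) - y j\<bar> powr p))"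
    have F: "\<bar>F\<bar> \<le> E"
    proof (cases "M = 0")
      case True
      then show ?thesis using E(1) by (simp add: F_def)
    next
      case False
      have sub: "r + (q + 1) * b \<le> i" if "q < M" for q
        using mult_le_mono1[of "q + 1" M b] that by (simp add: i_def)
      have "F = (\<Sum>q<M. \<bar>x (real (r + (q + 1) * b) / 2 ^ m) - x (real (r + q * b) / 2 ^ m)\<bar> powr p -
        (\<Sum>j\<in>block b r q. \<bar>x (real (j + 1) / 2 ^ m) - x (real j / 2 ^ m)\<bar> powr p))"
        unfolding F_def
      proof (intro sum.cong refl arg_cong2[where f = "(-)"])
        fix q assume "q \<in> {..<M}"
        then have *: "r + (q + 1) * b \<le> i" "r + q * b \<le> i"
          using sub[of q] by auto
        show "\<bar>y (r + (q + 1) * b) - y (r + q * b)\<bar> powr p =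
            \<bar>x (real (r + (q + 1) * b) / 2 ^ m) - x (real (r + q * b) / 2 ^ m)\<bar> powr p"
          unfolding y[OF *(1)] y[OF *(2)] ..
        fix j assume "j \<in> block b r q"
        then have "Suc j \<le> i" "j \<le> i"
          using * by (auto simp: block_def)
        then show "\<bar>y (Suc j) - y j\<bar> powr p = \<bar>x (real (j + 1) / 2 ^ m) - x (real j / 2 ^ m)\<bar> powr p"
          by (simp add: y)
      qed
      then show ?thesis
        using E(2)[of M] False Mm by simp
    qed
    have blocks: "(\<Sum>q<M. \<Sum>j\<in>block b r q. \<bar>y (Suc j) - y j\<bar> powr p) = (\<Sum>j = r..<i. \<bar>y (Suc j) - y j\<bar> powr p)"
      unfolding i_def block_def
    proof (induction M)
      case (Suc M)
      have "sum f {r..<r + Suc M * b} = sum f {r..<r + M * b} + sum f {r + M * b..<r + Suc M * b}" for f :: "nat \<Rightarrow> real"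
        by (rule sum.atLeastLessThan_concat[symmetric]) simp_all
      with Suc show ?case by simp
    qed simp
    \<comment> \<open>The last block may reach past 1. This is harmless, since the stopped path is
      constant after \<open>t\<close>.\<close>
    have "pvariation p (coarse_grid m b r) x t - pvariation p (dyadic_grid m) x t =
       (\<bar>y r - y 0\<bar> powr p - (\<Sum>j\<in>{0..<0 + r}. \<bar>y (Suc j) - y j\<bar> powr p)) + F +
       (\<bar>y (i + b) - y i\<bar> powr p - (\<Sum>j\<in>{i..<i + b}. \<bar>y (Suc j) - y j\<bar> powr p))"
    proof -
      have "{..<r + Suc M * b} = {0..<0 + r} \<union> ({r..<i} \<union> {i..<i + b})"
        by (auto simp: i_def)
      then have "pvariation p (dyadic_grid m) x t =
          (\<Sum>j\<in>{0..<0 + r} \<union> ({r..<i} \<union> {i..<i + b}). \<bar>y (Suc j) - y j\<bar> powr p)"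
        using fine[OF M(2)] by (simp only:)
      also have "\<dots> = (\<Sum>j\<in>{0..<0 + r}. \<bar>y (Suc j) - y j\<bar> powr p) +
          ((\<Sum>j = r..<i. \<bar>y (Suc j) - y j\<bar> powr p) + (\<Sum>j\<in>{i..<i + b}. \<bar>y (Suc j) - y j\<bar> powr p))"
        by (subst sum.union_disjoint; (subst sum.union_disjoint)?) (auto simp: i_def)
      finally show ?thesis
        unfolding coarse[OF M(2)] F_def sum_subtractf blocks[symmetric] by (simp add: i_def algebra_simps)
    qed
    moreover have "\<bar>y r - y 0\<bar> powr p \<le> h * real r" "\<bar>y (i + b) - y i\<bar> powr p \<le> h * real b"
      by (intro le; simp)+
    moreover have "h * real r \<le> h * real b" "0 \<le> h * real b"
      using b h by (auto intro!: mult_left_mono)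
    moreover have "0 \<le> (\<Sum>j\<in>{k..<k + l}. \<bar>y (Suc j) - y j\<bar> powr p)" for k l
      by (intro sum_nonneg) simp
    from this[of 0 r] this[of i b] have "0 \<le> (\<Sum>j\<in>{0..<0 + r}. \<bar>y (Suc j) - y j\<bar> powr p)"
      "0 \<le> (\<Sum>j\<in>{i..<i + b}. \<bar>y (Suc j) - y j\<bar> powr p)" .
    ultimately show ?thesis
      unfolding bound using sum_le[of 0 r] sum_le[of i b] F
        powr_ge_zero[of "\<bar>y r - y 0\<bar>" p] powr_ge_zero[of "\<bar>y (i + b) - y i\<bar>" p]
      by linarith
  qed
qed

subsection \<open>Limits of grids and of dyadic variations\<close>

lemma isCont_stopped:
  assumes "continuous_on {0..1} x" "0 \<le> t" "t \<le> 1"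
  shows "isCont (stopped x t) u"
proof -
  have "continuous_on UNIV (stopped x t)"
    unfolding stopped_def using assms
    by (intro continuous_on_compose2[OF assms(1)] continuous_intros) auto
  then show ?thesis
    by (simp add: continuous_on_eq_continuous_at)
qed

text \<open>With the number of terms fixed, each term is continuous in mesh and shift. Grid points
  entering or leaving the unit interval cause no jump, because clamping makes their cells short
  before they disappear.\<close>

lemma pvariation_shifted_grid_tendsto:
  assumes x: "continuous_on {0..1} x" and p: "0 < p" and t: "0 \<le> t" "t \<le> 1" and s: "0 \<le> s" "s < l"
    and L: "L \<longlonglongrightarrow> l" and S: "S \<longlonglongrightarrow> s" and SL: "\<forall>\<^sub>F m in sequentially. 0 \<le> S m \<and> S m < L m"
  shows "(\<lambda>m. pvariation p (shifted_grid (L m) (S m)) x t) \<longlonglongrightarrow> pvariation p (shifted_grid l s) x t"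
proof -
  have "0 < l" using s by simp
  obtain N :: nat where "1 / l < real N"
    using reals_Archimedean2 by blast
  \<comment> \<open>The inequality is strict so that it persists for the approximating meshes and
    shifts.\<close>
  then have N: "t < s + real N * l"
    using \<open>0 < l\<close> s t by (simp add: field_simps)
  have "(\<lambda>m. S m + real N * L m) \<longlonglongrightarrow> s + real N * l"
    by (intro tendsto_intros L S)
  then have "\<forall>\<^sub>F m in sequentially. t < S m + real N * L m"
    by (rule order_tendstoD) (rule N)
  then have "\<forall>\<^sub>F m in sequentially.
      (\<Sum>k<Suc N. \<bar>stopped x t (S m + real k * L m) - stopped x t (S m + (real k - 1) * L m)\<bar> powr p) =
      pvariation p (shifted_grid (L m) (S m)) x t"
    using SL by eventually_elim (rule pvariation_shifted_grid[OF t, symmetric], auto)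
  moreover have "(\<lambda>m. \<Sum>k<Suc N. \<bar>stopped x t (S m + real k * L m) - stopped x t (S m + (real k - 1) * L m)\<bar> powr p)
     \<longlonglongrightarrow> (\<Sum>k<Suc N. \<bar>stopped x t (s + real k * l) - stopped x t (s + (real k - 1) * l)\<bar> powr p)"
    using p by (intro tendsto_sum tendsto_powr' tendsto_rabs tendsto_diff tendsto_const
        isCont_tendsto_compose[OF isCont_stopped[OF x t]] tendsto_add tendsto_mult L S) auto
  ultimately show ?thesis
    unfolding pvariation_shifted_grid[OF t s less_imp_le[OF N]] by (rule Lim_transform_eventually[rotated])
qed

section \<open>Weak limits of the dyadic measures and their distribution functions\<close>

lemma lebesgue_integral_dyadic_measure:
  assumes "continuous_on {0..1} f"
  shows "integral\<^sup>L (dyadic_measure p x m) f =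
    (\<Sum>j<2 ^ m. \<bar>x (real (j + 1) / 2 ^ m) - x (real j / 2 ^ m)\<bar> powr p * f (real j / 2 ^ m))"
proof -
  have "f \<in> borel_measurable (restrict_space borel {0..1})"
    by (rule borel_measurable_continuous_on_restrict[OF assms])
  moreover have "real j / 2 ^ m \<in> {0..1}" if "j < 2 ^ m" for j :: nat
  proof -
    have "real j \<le> real (2 ^ m)"
      using that by (simp only: of_nat_le_iff less_imp_le)
    then show ?thesis
      by (simp add: divide_le_eq)
  qed
  ultimately have "integral\<^sup>L (dyadic_measure p x m) f =
      (\<integral>j. f (real j / 2 ^ m) \<partial>point_measure {..<2 ^ m}
        (\<lambda>j::nat. ennreal (\<bar>x (real (j + 1) / 2 ^ m) - x (real j / 2 ^ m)\<bar> powr p)))"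
    unfolding dyadic_measure_def by (intro integral_distr) (auto simp: space_restrict_space)
  also have "\<dots> = (\<Sum>j<2 ^ m. \<bar>x (real (j + 1) / 2 ^ m) - x (real j / 2 ^ m)\<bar> powr p * f (real j / 2 ^ m))"
    by (subst lebesgue_integral_point_measure_finite) auto
  finally show ?thesis .
qed

text \<open>A continuous cutoff between the indicators of \<open>{..a}\<close> and
  \<open>{..a + d}\<close>, as weak convergence is tested on continuous functions.\<close>

definition ramp :: "real \<Rightarrow> real \<Rightarrow> real \<Rightarrow> real" where
  "ramp a d u = max 0 (min 1 ((a + d - u) / d))"

lemma ramp_bounds: "0 \<le> ramp a d u" "ramp a d u \<le> 1"
  by (auto simp: ramp_def)

lemma ramp_eq_1: "0 < d \<Longrightarrow> u \<le> a \<Longrightarrow> ramp a d u = 1"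
  by (auto simp: ramp_def field_simps)

lemma ramp_eq_0: "0 < d \<Longrightarrow> a + d \<le> u \<Longrightarrow> ramp a d u = 0"
  by (auto simp: ramp_def max_def min_def field_simps)

lemma continuous_on_ramp: "0 < d \<Longrightarrow> continuous_on A (ramp a d)"
  unfolding ramp_def by (intro continuous_intros) auto

text \<open>The intersection gives a measurable set for every real \<open>t\<close>, so arguments
  such as \<open>t - 2 * d\<close> outside the unit interval are admissible.\<close>

definition unit_cdf :: "real measure \<Rightarrow> real \<Rightarrow> real" where
  "unit_cdf \<mu> t = measure \<mu> ({0..1} \<inter> {..t})"

context
  fixes p :: real and x :: "real \<Rightarrow> real" and \<mu> :: "real measure"
  assumes limit: "is_dyadic_limit p x \<mu>"
begin

lemma sets_limit: "sets \<mu> = sets (restrict_space borel {0..1})"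
  using limit by (simp add: is_dyadic_limit_def)

lemma space_limit: "space \<mu> = {0..1}"
  using sets_eq_imp_space_eq[OF sets_limit] by (simp add: space_restrict_space)

lemma borel_Int_sets_limit: "B \<in> sets borel \<Longrightarrow> {0..1} \<inter> B \<in> sets \<mu>"
  unfolding sets_limit by (auto simp: sets_restrict_space)

lemma limit_measurable: "(\<lambda>u. u) \<in> measurable \<mu> borel"
  unfolding measurable_cong_sets[OF sets_limit refl] by (rule measurable_restrict_space1) simp

text \<open>Pushing the measure forward to the real line makes the general theory of distribution
  functions applicable.\<close>

lemma limit_distr_borel: "finite_borel_measure (distr \<mu> borel (\<lambda>u. u))"
proof -
  interpret \<mu>: finite_measure \<mu>
    using limit by (simp add: is_dyadic_limit_def)
  interpret finite_measure "distr \<mu> borel (\<lambda>u. u)"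
    by (rule \<mu>.finite_measure_distr[OF limit_measurable])
  show ?thesis
    by unfold_locales simp
qed

lemma measure_limit_distr:
  "B \<in> sets borel \<Longrightarrow> measure (distr \<mu> borel (\<lambda>u. u)) B = measure \<mu> ({0..1} \<inter> B)"
  by (simp add: measure_distr[OF limit_measurable] space_limit Int_commute)

lemma unit_cdf_eq_cdf: "unit_cdf \<mu> = cdf (distr \<mu> borel (\<lambda>u. u))"
  unfolding cdf_def unit_cdf_def by (simp add: measure_limit_distr)

lemma unit_cdf_eq: "t \<in> {0..1} \<Longrightarrow> unit_cdf \<mu> t = measure \<mu> {0..t}"
proof -
  assume "t \<in> {0..1}"
  then have "{0..1} \<inter> {..t} = {0..t}" by auto
  then show ?thesis by (simp only: unit_cdf_def)
qed

lemma mono_unit_cdf: "mono (unit_cdf \<mu>)"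
  unfolding unit_cdf_eq_cdf mono_def
  using finite_borel_measure.cdf_nondecreasing[OF limit_distr_borel] by blast

lemma measure_limit_singleton: "measure \<mu> ({0..1} \<inter> {t}) = 0"
  using limit by (cases "t \<in> {0..1}") (auto simp: is_dyadic_limit_def measure_def)

text \<open>The jumps of a distribution function are its point masses, which nonatomicity
  excludes.\<close>

lemma isCont_unit_cdf: "isCont (unit_cdf \<mu>) t"
  unfolding unit_cdf_eq_cdf finite_borel_measure.isCont_cdf[OF limit_distr_borel]
  by (simp add: measure_limit_distr measure_limit_singleton)

lemma unit_cdf_0: "unit_cdf \<mu> 0 = 0"
proof -
  have "{0..1} \<inter> {..0} = {0..1} \<inter> {0::real}" by auto
  then show ?thesis
    unfolding unit_cdf_def by (simp only: measure_limit_singleton)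
qed

lemma integral_ramp_bounds:
  assumes "0 < d"
  shows "unit_cdf \<mu> a \<le> integral\<^sup>L \<mu> (ramp a d)" "integral\<^sup>L \<mu> (ramp a d) \<le> unit_cdf \<mu> (a + d)"
proof -
  interpret finite_measure \<mu>
    using limit by (simp add: is_dyadic_limit_def)
  have "ramp a d \<in> borel_measurable \<mu>"
    unfolding measurable_cong_sets[OF sets_limit refl]
    using continuous_on_ramp[OF assms] by (rule borel_measurable_continuous_on_restrict)
  then have int: "integrable \<mu> (ramp a d)"
    using ramp_bounds by (intro integrable_const_bound[where B = 1]) auto
  have ind: "integrable \<mu> (indicator ({0..1} \<inter> {..c}) :: real \<Rightarrow> real)"
    "integral\<^sup>L \<mu> (indicator ({0..1} \<inter> {..c})) = unit_cdf \<mu> c" for c :: real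
    using borel_Int_sets_limit[of "{..c}"]
    by (auto simp: unit_cdf_def space_limit less_top[symmetric] Int_commute Int_assoc)
  show "unit_cdf \<mu> a \<le> integral\<^sup>L \<mu> (ramp a d)"
    unfolding ind(2)[symmetric]
    by (rule integral_mono[OF ind(1) int]) (auto simp: indicator_def ramp_bounds ramp_eq_1 assms)
  show "integral\<^sup>L \<mu> (ramp a d) \<le> unit_cdf \<mu> (a + d)"
    unfolding ind(2)[symmetric]
    by (rule integral_mono[OF int ind(1)])
      (auto simp: indicator_def ramp_bounds ramp_eq_0 assms space_limit)
qed

text \<open>The stopped variation is squeezed between integrals of two ramps against the dyadic
  measure, up to the one increment that straddles \<open>t\<close>. First \<open>m\<close> tends to
  infinity with the width \<open>d\<close> fixed; then continuity of \<open>unit_cdf \<mu>\<close>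
  closes the gap.\<close>

lemma pvariation_dyadic_grid_tendsto:
  assumes p: "0 < p" and H: "holder_bound p x H" and t: "0 \<le> t" "t \<le> 1"
  shows "(\<lambda>m. pvariation p (dyadic_grid m) x t) \<longlonglongrightarrow> unit_cdf \<mu> t"
proof -
  define I where "I m f = integral\<^sup>L (dyadic_measure p x m) f" for m and f :: "real \<Rightarrow> real"
  define w where "w m j = \<bar>x (real (j + 1) / 2 ^ m) - x (real j / 2 ^ m)\<bar> powr p" for m j
  define v where "v m j = \<bar>stopped x t (real (j + 1) / 2 ^ m) - stopped x t (real j / 2 ^ m)\<bar> powr p" for m j
  have w: "0 \<le> w m j" for m j by (simp add: w_def)
  have v: "0 \<le> v m j" for m j by (simp add: v_def)
  have V: "pvariation p (dyadic_grid m) x t = (\<Sum>j<2 ^ m. v m j)" for m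
    unfolding v_def using t by (intro pvariation_dyadic_grid) auto
  have I: "I m (ramp a d) = (\<Sum>j<2 ^ m. w m j * ramp a d (real j / 2 ^ m))" if "0 < d" for m a d
    unfolding I_def w_def using lebesgue_integral_dyadic_measure[OF continuous_on_ramp[OF that]] .
  have lim: "(\<lambda>m. I m (ramp a d)) \<longlonglongrightarrow> integral\<^sup>L \<mu> (ramp a d)" if "0 < d" for a d
    unfolding I_def using limit continuous_on_ramp[OF that] by (auto simp: is_dyadic_limit_def)
  have v_eq: "v m j = w m j" if "real (j + 1) / 2 ^ m \<le> t" for m j
  proof -
    have "real j / 2 ^ m \<le> real (j + 1) / 2 ^ m"
      by (simp add: divide_right_mono)
    then show ?thesis
      using that unfolding v_def w_def by (simp add: stopped_eq(1))
  qed
  have step: "real (j + 1) / 2 ^ m = real j / 2 ^ m + (1 / 2) ^ m" for m j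
    by (simp add: power_one_over add_divide_distrib)
  have upper: "pvariation p (dyadic_grid m) x t \<le> I m (ramp t d) + H powr p * (1 / 2) ^ m" if "0 < d" for m d
  proof -
    \<comment> \<open>The termwise comparison can fail only for the interval with \<open>t\<close>
      in its interior, whose index is \<open>J\<close>; its stopped increment is controlled by the
      Hoelder bound.\<close>
    define J where "J = nat \<lfloor>t * 2 ^ m\<rfloor>"
    have "v m j \<le> w m j * ramp t d (real j / 2 ^ m) + (if j = J then H powr p * (1 / 2) ^ m else 0)" for j
    proof -
      consider "real (j + 1) / 2 ^ m \<le> t" | "t \<le> real j / 2 ^ m" | "real j / 2 ^ m < t" "t < real (j + 1) / 2 ^ m"
        by linarith
      then show ?thesis
      proof cases
        case 1
        have "real j / 2 ^ m \<le> real (j + 1) / 2 ^ m"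
          by (simp add: divide_right_mono)
        then have "ramp t d (real j / 2 ^ m) = 1"
          using 1 that by (intro ramp_eq_1) auto
        then show ?thesis
          using v_eq[OF 1] by simp
      next
        case 2
        have "real j / 2 ^ m \<le> real (j + 1) / 2 ^ m"
          by (simp add: divide_right_mono)
        then have "v m j = 0"
          using 2 t by (simp add: v_def stopped_eq(2))
        then show ?thesis
          using w ramp_bounds by simp
      next
        case 3
        then have "\<lfloor>t * 2 ^ m\<rfloor> = int j"
          by (intro floor_unique) (auto simp: field_simps)
        then have "j = J" by (simp add: J_def)
        moreover have "v m j \<le> H powr p * \<bar>real (j + 1) / 2 ^ m - real j / 2 ^ m\<bar>"
          unfolding v_def by (rule stopped_powr_le[OF H p t])
        moreover have "\<bar>real (j + 1) / 2 ^ m - real j / 2 ^ m\<bar> = (1 / 2) ^ m"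
          unfolding step by simp
        moreover have "0 \<le> w m j * ramp t d (real j / 2 ^ m)"
          using w ramp_bounds by simp
        ultimately show ?thesis by simp
      qed
    qed
    then have "(\<Sum>j<2 ^ m. v m j) \<le>
        (\<Sum>j<2 ^ m. w m j * ramp t d (real j / 2 ^ m) + (if j = J then H powr p * (1 / 2) ^ m else 0))"
      by (intro sum_mono)
    also have "\<dots> \<le> I m (ramp t d) + H powr p * (1 / 2) ^ m"
      by (simp add: sum.distrib I[OF that] sum.delta)
    finally show ?thesis
      by (simp add: V)
  qed
  \<comment> \<open>This ramp vanishes from \<open>t - d\<close> on. An interval that ends after
    \<open>t\<close> starts after \<open>t - (1 / 2) ^ m\<close>, hence after \<open>t - d\<close>,
    and so contributes nothing to the left side.\<close>
  have lower: "I m (ramp (t - 2 * d) d) \<le> pvariation p (dyadic_grid m) x t" if "0 < d" "(1 / 2) ^ m \<le> d" for m d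
    unfolding V I[OF that(1)]
  proof (rule sum_mono)
    fix j
    show "w m j * ramp (t - 2 * d) d (real j / 2 ^ m) \<le> v m j"
    proof (cases "real (j + 1) / 2 ^ m \<le> t")
      case True
      then show ?thesis
        using w ramp_bounds by (simp add: v_eq mult_left_le)
    next
      case False
      then have "ramp (t - 2 * d) d (real j / 2 ^ m) = 0"
        using that unfolding step by (intro ramp_eq_0) auto
      then show ?thesis
        using v by simp
    qed
  qed
  have half: "(\<lambda>m. (1 / 2) ^ m :: real) \<longlonglongrightarrow> 0"
    by (rule LIMSEQ_power_zero) simp
  show ?thesis
  proof (rule order_tendstoI)
    fix c assume "c < unit_cdf \<mu> t"
    moreover have "((\<lambda>d. unit_cdf \<mu> (t - 2 * d)) \<longlongrightarrow> unit_cdf \<mu> (t - 2 * 0)) (at_right 0)"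
      by (intro isCont_tendsto_compose[OF isCont_unit_cdf] tendsto_intros)
    ultimately have "\<forall>\<^sub>F d in at_right 0. c < unit_cdf \<mu> (t - 2 * d) \<and> (0::real) < d"
      by (intro eventually_conj eventually_at_right_less) (simp add: order_tendsto_iff)
    then obtain d where d: "c < unit_cdf \<mu> (t - 2 * d)" "0 < d"
      using eventually_happens'[OF trivial_limit_at_right_real] by blast
    have "c < integral\<^sup>L \<mu> (ramp (t - 2 * d) d)"
      using d integral_ramp_bounds(1)[OF d(2)] by (meson less_le_trans)
    then have "\<forall>\<^sub>F m in sequentially. c < I m (ramp (t - 2 * d) d)"
      by (rule order_tendstoD(1)[OF lim[OF d(2)]])
    moreover have "\<forall>\<^sub>F m in sequentially. (1 / 2) ^ m < d"
      by (rule order_tendstoD(2)[OF half d(2)])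
    ultimately show "\<forall>\<^sub>F m in sequentially. c < pvariation p (dyadic_grid m) x t"
    proof eventually_elim
      case (elim m)
      with lower[OF d(2), of m] show ?case by simp
    qed
  next
    fix c assume "unit_cdf \<mu> t < c"
    moreover have "((\<lambda>d. unit_cdf \<mu> (t + d)) \<longlongrightarrow> unit_cdf \<mu> (t + 0)) (at_right 0)"
      by (intro isCont_tendsto_compose[OF isCont_unit_cdf] tendsto_intros)
    ultimately have "\<forall>\<^sub>F d in at_right 0. unit_cdf \<mu> (t + d) < c \<and> (0::real) < d"
      by (intro eventually_conj eventually_at_right_less) (simp add: order_tendsto_iff)
    then obtain d where d: "unit_cdf \<mu> (t + d) < c" "0 < d"
      using eventually_happens'[OF trivial_limit_at_right_real] by blast
    have "integral\<^sup>L \<mu> (ramp t d) + H powr p * 0 < c"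
      using d integral_ramp_bounds(2)[OF d(2), of t] by simp
    then have "\<forall>\<^sub>F m in sequentially. I m (ramp t d) + H powr p * (1 / 2) ^ m < c"
      by (intro order_tendstoD(2)[OF tendsto_add[OF lim[OF d(2)] tendsto_mult[OF tendsto_const half]]])
    then show "\<forall>\<^sub>F m in sequentially. pvariation p (dyadic_grid m) x t < c"
    proof eventually_elim
      case (elim m)
      with upper[OF d(2), of m] show ?case by simp
    qed
  qed
qed

end

subsection \<open>Hoelder continuity\<close>

text \<open>The increment over a child interval is half the parent's increment plus or minus half
  the second difference \<open>D\<close>, and \<open>D\<close> at level \<open>m\<close> is at most
  \<open>S * q ^ m\<close>. The halving beats the decay rate \<open>q\<close> because \<alpha> < 1
  gives \<open>q > 1 / 2\<close>.\<close>

lemma dyadic_increment_le: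
  fixes \<alpha> S :: real
  assumes \<alpha>: "\<alpha> < 1"
    and S: "\<And>m k. k < 2 ^ m \<Longrightarrow> 2 powr (real m * (\<alpha> - 1 / 2)) * \<bar>fs_coeff x m k\<bar> \<le> S"
  obtains B where "0 \<le> B"
    "\<And>m j. j < 2 ^ m \<Longrightarrow> \<bar>x (real (j + 1) / 2 ^ m) - x (real j / 2 ^ m)\<bar> \<le> B * (2 powr - \<alpha>) ^ m"
proof -
  define q where "q = 2 powr - \<alpha>"
  have "2 powr - 1 < q"
    unfolding q_def using \<alpha> by (intro powr_less_mono) auto
  then have q: "1 / 2 < q"
    by (simp add: powr_minus_divide)
  define D where "D m k = 2 * x (real (2 * k + 1) / 2 ^ (m + 1)) - x (real k / 2 ^ m) - x (real (k + 1) / 2 ^ m)" for m k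
  have D: "\<bar>D m k\<bar> \<le> S * q ^ m" if "k < 2 ^ m" for m k
  proof -
    have "2 powr (real m * (\<alpha> - 1 / 2)) * \<bar>fs_coeff x m k\<bar> =
        2 powr (real m * (\<alpha> - 1 / 2)) * 2 powr (real m / 2) * \<bar>D m k\<bar>"
      by (simp add: fs_coeff_def D_def abs_mult)
    also have "2 powr (real m * (\<alpha> - 1 / 2)) * 2 powr (real m / 2) = 2 powr (real m * \<alpha>)"
      unfolding powr_add[symmetric] by (simp add: algebra_simps)
    finally have "2 powr (real m * \<alpha>) * \<bar>D m k\<bar> \<le> S"
      using S[OF that] by simp
    then have "\<bar>D m k\<bar> \<le> S * 2 powr - (real m * \<alpha>)"
      by (simp add: powr_minus field_simps)
    also have "2 powr - (real m * \<alpha>) = q ^ m"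
      unfolding q_def by (simp add: powr_powr mult.commute flip: powr_realpow)
    finally show ?thesis .
  qed
  \<comment> \<open>\<open>S / (2 * q - 1)\<close> is the least \<open>B\<close> with \<open>(B + S) / 2 \<le> B * q\<close>, as the induction over the levels needs\<close>
  define B where "B = max \<bar>x 1 - x 0\<bar> (S / (2 * q - 1))"
  have B: "0 \<le> B" "\<bar>x 1 - x 0\<bar> \<le> B"
    by (auto simp: B_def)
  have "S / (2 * q - 1) \<le> B"
    by (simp add: B_def)
  then have SB: "(B + S) / 2 \<le> B * q"
    using q by (simp add: field_simps)
  have "\<bar>x (real (j + 1) / 2 ^ m) - x (real j / 2 ^ m)\<bar> \<le> B * q ^ m" if "j < 2 ^ m" for m j
    using that
  proof (induction m arbitrary: j)
    case 0
    then show ?case using B by simp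
  next
    case (Suc m)
    define k where "k = j div 2"
    have k: "k < 2 ^ m"
      using Suc.prems by (simp add: k_def less_mult_imp_div_less mult.commute)
    define d where "d = x (real (k + 1) / 2 ^ m) - x (real k / 2 ^ m)"
    define e where "e = x (real (j + 1) / 2 ^ Suc m) - x (real j / 2 ^ Suc m)"
    have "e = (d + D m k) / 2 \<or> e = (d - D m k) / 2"
    proof (cases "even j")
      case True
      then have "j = 2 * k" by (simp add: k_def)
      then have "real j / 2 ^ Suc m = real k / 2 ^ m" "real (j + 1) / 2 ^ Suc m = real (2 * k + 1) / 2 ^ (m + 1)"
        by simp_all
      then show ?thesis
        by (simp only: e_def d_def D_def) argo
    next
      case False
      then have "j = 2 * k + 1" by (simp add: k_def)
      then have "real (j + 1) / 2 ^ Suc m = real (k + 1) / 2 ^ m" "real j / 2 ^ Suc m = real (2 * k + 1) / 2 ^ (m + 1)"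
        by (simp_all add: field_simps)
      then show ?thesis
        by (simp only: e_def d_def D_def) argo
    qed
    then have "\<bar>e\<bar> \<le> (\<bar>d\<bar> + \<bar>D m k\<bar>) / 2"
      using abs_triangle_ineq[of d "D m k"] abs_triangle_ineq4[of d "D m k"] by auto
    also have "\<dots> \<le> (B * q ^ m + S * q ^ m) / 2"
      by (rule divide_right_mono[OF add_mono[OF Suc.IH[OF k, folded d_def] D[OF k]]]) simp
    also have "\<dots> = (B + S) / 2 * q ^ m"
      by (simp add: algebra_simps)
    also have "\<dots> \<le> B * q * q ^ m"
      using SB q by (intro mult_right_mono) auto
    finally show ?case by (simp add: e_def mult.assoc)
  qed
  with B show ?thesis
    using that unfolding q_def by blast
qed

text \<open>Rounding \<open>u\<close> down at the levels \<open>n\<close>, \<open>n + 1\<close>, and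
  so on gives points tending to \<open>u\<close>. Two successive ones coincide or bound a single
  interval of the finer level, so the changes of \<open>x\<close> are dominated by a geometric
  series, and continuity carries the bound to \<open>u\<close>.\<close>

lemma dyadic_approximation_le:
  fixes q B :: real
  assumes x: "continuous_on {0..1} x" and q: "0 < q" "q < 1" and B: "0 \<le> B"
    and inc: "\<And>m j. j < 2 ^ m \<Longrightarrow> \<bar>x (real (j + 1) / 2 ^ m) - x (real j / 2 ^ m)\<bar> \<le> B * q ^ m"
    and u: "0 \<le> u" "u \<le> 1"
  shows "\<bar>x u - x (of_int \<lfloor>u * 2 ^ n\<rfloor> / 2 ^ n)\<bar> \<le> B / (1 - q) * q ^ n"
proof -
  define U where "U m = (of_int \<lfloor>u * 2 ^ m\<rfloor> :: real) / 2 ^ m" for m :: nat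
  have U: "0 \<le> U m" "U m \<le> u" "u - (1 / 2) ^ m \<le> U m" for m
  proof -
    show "0 \<le> U m"
      using u by (simp add: U_def)
    show "U m \<le> u"
      unfolding U_def by (simp add: divide_le_eq)
    have "u * 2 ^ m - 1 \<le> of_int \<lfloor>u * 2 ^ m\<rfloor>"
      by linarith
    then have "(u * 2 ^ m - 1) / 2 ^ m \<le> U m"
      unfolding U_def by (rule divide_right_mono) simp
    then show "u - (1 / 2) ^ m \<le> U m"
      by (simp add: diff_divide_distrib power_one_over)
  qed
  have step: "\<bar>x (U (Suc m)) - x (U m)\<bar> \<le> B * q ^ m" for m
  proof -
    define i where "i = nat \<lfloor>u * 2 ^ m\<rfloor>"
    have i: "\<lfloor>u * 2 ^ m\<rfloor> = int i"
      using u by (simp add: i_def)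
    have "\<lfloor>u * 2 ^ Suc m\<rfloor> = 2 * int i \<or> \<lfloor>u * 2 ^ Suc m\<rfloor> = 2 * int i + 1"
    proof -
      have "u * 2 ^ Suc m = 2 * (u * 2 ^ m)"
        by simp
      then show ?thesis
        using i by linarith
    qed
    then show ?thesis
    proof
      assume "\<lfloor>u * 2 ^ Suc m\<rfloor> = 2 * int i"
      then have "U (Suc m) = U m"
        by (simp add: U_def i)
      then show ?thesis using B q by simp
    next
      assume *: "\<lfloor>u * 2 ^ Suc m\<rfloor> = 2 * int i + 1"
      then have "real (2 * i) + 1 \<le> u * 2 ^ Suc m"
        by linarith
      also have "\<dots> \<le> 1 * 2 ^ Suc m"
        using u by (intro mult_right_mono) auto
      finally have "real (2 * i + 1) \<le> real (2 ^ Suc m)"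
        by simp
      then have "2 * i < 2 ^ Suc m"
        unfolding of_nat_le_iff by simp
      then have "\<bar>x (real (2 * i + 1) / 2 ^ Suc m) - x (real (2 * i) / 2 ^ Suc m)\<bar> \<le> B * q ^ Suc m"
        by (rule inc)
      moreover have "U (Suc m) = real (2 * i + 1) / 2 ^ Suc m" "U m = real (2 * i) / 2 ^ Suc m"
        unfolding U_def * i by simp_all
      moreover have "B * q ^ Suc m \<le> B * q ^ m"
        using q B by (intro mult_left_mono power_decreasing) auto
      ultimately show ?thesis
        by simp
    qed
  qed
  \<comment> \<open>The factor \<open>1 - q ^ k\<close> is the exact partial geometric sum, which
    lets the induction close.\<close>
  have "\<bar>x (U (n + k)) - x (U n)\<bar> \<le> B / (1 - q) * q ^ n * (1 - q ^ k)" for k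
  proof (induction k)
    case (Suc k)
    have "\<bar>x (U (n + Suc k)) - x (U n)\<bar> \<le> B * q ^ (n + k) + B / (1 - q) * q ^ n * (1 - q ^ k)"
      using Suc step[of "n + k"] by simp
    also have "\<dots> = B / (1 - q) * q ^ n * (1 - q ^ Suc k)"
      using q by (simp add: field_simps power_add)
    finally show ?case .
  qed simp
  moreover have "B / (1 - q) * q ^ n * (1 - q ^ k) \<le> B / (1 - q) * q ^ n * 1" for k
    using q B by (intro mult_left_mono) auto
  ultimately have le: "\<bar>x (U (n + k)) - x (U n)\<bar> \<le> B / (1 - q) * q ^ n" for k
    unfolding mult_1_right by (rule order_trans)
  have "U \<longlonglongrightarrow> u"
  proof (rule tendsto_sandwich)
    show "\<forall>\<^sub>F m in sequentially. u - (1 / 2) ^ m \<le> U m" "\<forall>\<^sub>F m in sequentially. U m \<le> u"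
      using U by auto
    have "(\<lambda>m. u - (1 / 2) ^ m) \<longlonglongrightarrow> u - 0"
      by (intro tendsto_intros LIMSEQ_power_zero) simp
    then show "(\<lambda>m. u - (1 / 2) ^ m) \<longlonglongrightarrow> u"
      by simp
  qed simp
  then have "(\<lambda>m. x (U m)) \<longlonglongrightarrow> x u"
  proof (rule continuous_on_tendsto_compose[OF x])
    show "u \<in> {0..1}"
      using u by simp
    show "\<forall>\<^sub>F m in sequentially. U m \<in> {0..1}"
      using U(1) order_trans[OF U(2) u(2)] by (intro always_eventually allI) simp
  qed
  then have "(\<lambda>k. x (U (n + k))) \<longlonglongrightarrow> x u"
    by (subst add.commute) (rule LIMSEQ_ignore_initial_segment)
  then have "(\<lambda>k. \<bar>x (U (n + k)) - x (U n)\<bar>) \<longlonglongrightarrow> \<bar>x u - x (U n)\<bar>"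
    by (intro tendsto_intros)
  then show ?thesis
    unfolding U_def[symmetric] by (rule LIMSEQ_le_const2) (use le in blast)
qed

text \<open>One direction of Ciesielski's characterisation of Hoelder functions. At the level
  \<open>n\<close> with \<open>2 ^ - n\<close> comparable to \<open>t - s\<close>, the roundings of
  \<open>s\<close> and \<open>t\<close> are equal or adjacent.\<close>

lemma holder_bound_if_fs_coeff_bounded:
  assumes p: "1 < p" and x: "continuous_on {0..1} x"
    and bdd: "bdd_above {2 powr (real m * (1 / p - 1 / 2)) * \<bar>fs_coeff x m k\<bar> | m k. k < 2 ^ m}"
  shows "\<exists>H. holder_bound p x H"
proof -
  obtain S where "\<And>y. y \<in> {2 powr (real m * (1 / p - 1 / 2)) * \<bar>fs_coeff x m k\<bar> | m k. k < 2 ^ m} \<Longrightarrow> y \<le> S"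
    using bdd unfolding bdd_above_def by blast
  then have S: "2 powr (real m * (1 / p - 1 / 2)) * \<bar>fs_coeff x m k\<bar> \<le> S" if "k < 2 ^ m" for m k
    using that by blast
  have p': "1 / p < 1" using p by simp
  obtain B where B: "0 \<le> B"
    and inc: "\<And>m j. j < 2 ^ m \<Longrightarrow> \<bar>x (real (j + 1) / 2 ^ m) - x (real j / 2 ^ m)\<bar> \<le> B * (2 powr - (1 / p)) ^ m"
    using dyadic_increment_le[OF p' S] by metis
  define q where "q = 2 powr - (1 / p)"
  note inc = inc[folded q_def]
  have "q < 2 powr 0"
    unfolding q_def using p by (intro powr_less_mono) auto
  then have q: "0 < q" "q < 1"
    by (auto simp: q_def)
  \<comment> \<open>Two rounding errors and one level-\<open>n\<close> increment; the last factor
    comes from \<open>q ^ n = 2 powr (- n / p)\<close> and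
    \<open>2 ^ - n < 2 * (t - s)\<close>.\<close>
  define H where "H = (2 * (B / (1 - q)) + B) * 2 powr (1 / p)"
  have holder: "\<bar>x t - x s\<bar> \<le> H * (t - s) powr (1 / p)" if st: "0 \<le> s" "s < t" "t \<le> 1" for s t
  proof -
    have "\<exists>n. (1 / 2) ^ Suc n < t - s"
    proof -
      obtain n where "(1 / 2) ^ n < t - s"
        using real_arch_pow_inv[of "t - s" "1 / 2"] st by auto
      moreover have "(1 / 2) ^ Suc n \<le> (1 / 2 :: real) ^ n"
        by (rule power_decreasing) auto
      ultimately show ?thesis
        using order.strict_trans1 by blast
    qed
    then have ex: "\<exists>n. (1 / 2) ^ Suc n < t - s \<and> (\<forall>k<n. \<not> (1 / 2) ^ Suc k < t - s)"
      by (rule exists_least_iff[THEN iffD1])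
    then obtain n where n: "(1 / 2) ^ Suc n < t - s" "\<And>k. k < n \<Longrightarrow> \<not> (1 / 2) ^ Suc k < t - s"
      by blast
    \<comment> \<open>Minimality of \<open>n\<close> gives this for \<open>n > 0\<close>; for
      \<open>n = 0\<close> it is \<open>t - s \<le> 1\<close>.\<close>
    have ts: "t - s \<le> (1 / 2) ^ n"
      using n(2)[of "n - 1"] st by (cases n) auto
    have qn: "q ^ n \<le> 2 powr (1 / p) * (t - s) powr (1 / p)"
    proof -
      have "q ^ n = ((1 / 2) ^ n) powr (1 / p)"
        unfolding q_def by (simp add: powr_minus_divide powr_divide power_one_over powr_powr mult.commute flip: powr_realpow)
      also have "\<dots> \<le> (2 * (t - s)) powr (1 / p)"
        using n(1) p by (intro powr_mono2) auto
      also have "\<dots> = 2 powr (1 / p) * (t - s) powr (1 / p)"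
        by (rule powr_mult)
      finally show ?thesis .
    qed
    define i where "i = nat \<lfloor>s * 2 ^ n\<rfloor>"
    have i: "\<lfloor>s * 2 ^ n\<rfloor> = int i"
      using st by (simp add: i_def)
    have "(t - s) * 2 ^ n \<le> (1 / 2) ^ n * 2 ^ n"
      using ts by (intro mult_right_mono) auto
    then have "t * 2 ^ n \<le> s * 2 ^ n + 1"
      by (simp add: left_diff_distrib flip: power_mult_distrib)
    moreover have "s * 2 ^ n \<le> t * 2 ^ n"
      using st by simp
    ultimately have "\<lfloor>t * 2 ^ n\<rfloor> = int i \<or> \<lfloor>t * 2 ^ n\<rfloor> = int i + 1"
      using i by linarith
    then have mid: "\<bar>x (of_int \<lfloor>t * 2 ^ n\<rfloor> / 2 ^ n) - x (of_int \<lfloor>s * 2 ^ n\<rfloor> / 2 ^ n)\<bar> \<le> B * q ^ n"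
    proof
      assume "\<lfloor>t * 2 ^ n\<rfloor> = int i"
      then show ?thesis using B q by (simp add: i)
    next
      assume *: "\<lfloor>t * 2 ^ n\<rfloor> = int i + 1"
      then have "real i + 1 \<le> t * 2 ^ n"
        by linarith
      also have "\<dots> \<le> 1 * 2 ^ n"
        using st by (intro mult_right_mono) auto
      finally have "real (i + 1) \<le> real (2 ^ n)"
        by simp
      then have "i < 2 ^ n"
        unfolding of_nat_le_iff by simp
      from inc[OF this] show ?thesis
        unfolding * i by (simp add: add.commute)
    qed
    have "\<bar>x t - x (of_int \<lfloor>t * 2 ^ n\<rfloor> / 2 ^ n)\<bar> \<le> B / (1 - q) * q ^ n"
      "\<bar>x s - x (of_int \<lfloor>s * 2 ^ n\<rfloor> / 2 ^ n)\<bar> \<le> B / (1 - q) * q ^ n"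
      using st by (intro dyadic_approximation_le[OF x q B inc]; simp)+
    with mid have "\<bar>x t - x s\<bar> \<le> 2 * (B / (1 - q) * q ^ n) + B * q ^ n"
      by linarith
    also have "\<dots> = (2 * (B / (1 - q)) + B) * q ^ n"
      by (simp add: algebra_simps)
    also have "\<dots> \<le> (2 * (B / (1 - q)) + B) * (2 powr (1 / p) * (t - s) powr (1 / p))"
      using qn B q by (intro mult_left_mono) auto
    finally show ?thesis
      by (simp add: H_def mult.assoc)
  qed
  have "\<bar>x t - x s\<bar> \<le> H * \<bar>t - s\<bar> powr (1 / p)" if "s \<in> {0..1}" "t \<in> {0..1}" for s t
    using holder[of s t] holder[of t s] that
    by (cases s t rule: linorder_cases) (auto simp: abs_minus_commute)
  then show ?thesis
    unfolding holder_bound_def by blast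
qed

subsection \<open>Roughness\<close>

text \<open>A block contributes \<open>h\<close> times its \<open>G\<close>, and disjoint blocks of
  length \<open>h\<close> in the unit interval number at most \<open>1 / h\<close>. As \<eta> \<le>
  1, \<open>M powr (1 - \<eta>)\<close> is monotone in \<open>M\<close>, and
  \<open>h * (1 / h) powr (1 - \<eta>)\<close> is \<open>h powr \<eta>\<close>.\<close>

lemma coarse_pvariation_diff_le_powr:
  assumes p: "1 < p" and H: "holder_bound p x H" and t: "0 \<le> t" "t \<le> 1"
    and m: "1 \<le> m" and b: "b \<le> 2 ^ m" "r < b"
    and \<theta>: "\<And>m k. k < 2 ^ m \<Longrightarrow> \<theta> m k = fs_coeff x m k"
    and \<eta>: "0 < \<eta>" "\<eta> \<le> 1" and C: "0 \<le> C"
    and blocks: "\<And>M. 1 \<le> M \<Longrightarrow> \<forall>q<M. full_block m b r q \<Longrightarrow>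
      \<bar>\<Sum>q<M. G p m b r q (x 1 - x 0) \<theta>\<bar> \<le> C * real M powr (1 - \<eta>)"
  shows "\<bar>pvariation p (coarse_grid m b r) x t - pvariation p (dyadic_grid m) x t\<bar>
    \<le> C * (real b / 2 ^ m) powr \<eta> + 2 * H powr p * (real b / 2 ^ m)"
proof (rule coarse_pvariation_diff_le)
  fix M assume M: "1 \<le> M" "r + M * b \<le> 2 ^ m"
  define h where "h = real b / 2 ^ m"
  have h: "0 < h"
    using b by (simp add: h_def)
  have full: "full_block m b r q" if "q < M" for q
    using mult_le_mono1[of "q + 1" M b] that M(2) by (simp add: full_block_def)
  define F where "F q = \<bar>x (real (r + (q + 1) * b) / 2 ^ m) - x (real (r + q * b) / 2 ^ m)\<bar> powr p -
        (\<Sum>j\<in>block b r q. \<bar>x (real (j + 1) / 2 ^ m) - x (real j / 2 ^ m)\<bar> powr p)" for q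
  have "F q = h * G p m b r q (x 1 - x 0) \<theta>" if "q < M" for q
  proof -
    have "G p m b r q (x 1 - x 0) \<theta> = 2 ^ m / real b * F q"
      unfolding F_def using \<theta> full[OF that] p by (intro G_eq) auto
    then show ?thesis
      using b by (simp add: h_def)
  qed
  then have "(\<Sum>q<M. F q) = h * (\<Sum>q<M. G p m b r q (x 1 - x 0) \<theta>)"
    by (simp add: sum_distrib_left)
  then have "\<bar>\<Sum>q<M. F q\<bar> = h * \<bar>\<Sum>q<M. G p m b r q (x 1 - x 0) \<theta>\<bar>"
    using h by (simp add: abs_mult)
  also have "\<dots> \<le> h * (C * real M powr (1 - \<eta>))"
    using blocks[OF M(1)] full h by (intro mult_left_mono) auto
  also have "\<dots> \<le> h * (C * (1 / h) powr (1 - \<eta>))"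
  proof -
    have "real (M * b) \<le> real (2 ^ m)"
      using M(2) by (simp only: of_nat_le_iff)
    then have "real M \<le> 1 / h"
      using b by (simp add: h_def field_simps)
    then show ?thesis
      using h C \<eta> by (intro mult_left_mono powr_mono2) auto
  qed
  also have "(1 / h) powr (1 - \<eta>) = h powr - (1 - \<eta>)"
    unfolding powr_minus_divide by (simp add: powr_divide)
  also have "h * (C * h powr - (1 - \<eta>)) = C * (h powr 1 * h powr - (1 - \<eta>))"
    using h by simp
  also have "\<dots> = C * h powr \<eta>"
    unfolding powr_add[symmetric] by simp
  finally show "\<bar>\<Sum>q<M. F q\<bar> \<le> C * h powr \<eta>" .
qed (use assms in auto)

text \<open>Rounding \<open>l\<close> and \<open>s\<close> down to level \<open>m\<close> gives
  admissible dyadic parameters: \<open>s < l\<close> yields \<open>r m < b m\<close> for large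
  \<open>m\<close>, and \<open>l \<le> 1\<close> yields \<open>b m \<le> 2 ^ m\<close>. Continuity
  of \<omega> at \<open>l\<close> transports the bound to the limit.\<close>

lemma grid_limit_le:
  assumes p: "0 < p" and x: "continuous_on {0..1} x" and t: "0 \<le> t" "t \<le> 1"
    and s: "0 \<le> s" "s < l" and l: "l \<le> 1"
    and lim: "(\<lambda>m. pvariation p (dyadic_grid m) x t) \<longlonglongrightarrow> v"
    and \<omega>: "isCont \<omega> l"
    and le: "\<And>m b r. 1 \<le> m \<Longrightarrow> b \<le> 2 ^ m \<Longrightarrow> r < b \<Longrightarrow>
      \<bar>pvariation p (coarse_grid m b r) x t - pvariation p (dyadic_grid m) x t\<bar> \<le> \<omega> (real b / 2 ^ m)"
  shows "\<bar>pvariation p (shifted_grid l s) x t - v\<bar> \<le> \<omega> l"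
proof -
  define b r where "b m = nat \<lfloor>l * 2 ^ m\<rfloor>" and "r m = nat \<lfloor>s * 2 ^ m\<rfloor>" for m :: nat
  have floor_tendsto: "(\<lambda>m. real (nat \<lfloor>u * 2 ^ m\<rfloor>) / 2 ^ m) \<longlonglongrightarrow> u" if "0 \<le> u" for u :: real
  proof (rule tendsto_sandwich)
    have "u - (1 / 2) ^ m \<le> real (nat \<lfloor>u * 2 ^ m\<rfloor>) / 2 ^ m \<and> real (nat \<lfloor>u * 2 ^ m\<rfloor>) / 2 ^ m \<le> u" for m
    proof -
      have "real (nat \<lfloor>u * 2 ^ m\<rfloor>) = of_int \<lfloor>u * 2 ^ m\<rfloor>"
        using that by simp
      moreover have "u * 2 ^ m - 1 \<le> of_int \<lfloor>u * 2 ^ m\<rfloor>" "of_int \<lfloor>u * 2 ^ m\<rfloor> \<le> u * 2 ^ m"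
        by linarith+
      ultimately have "(u * 2 ^ m - 1) / 2 ^ m \<le> real (nat \<lfloor>u * 2 ^ m\<rfloor>) / 2 ^ m"
        "real (nat \<lfloor>u * 2 ^ m\<rfloor>) / 2 ^ m \<le> u * 2 ^ m / 2 ^ m"
        by (simp_all only: divide_right_mono zero_le_power zero_le_numeral)
      then show ?thesis
        by (simp add: diff_divide_distrib power_one_over)
    qed
    then show "\<forall>\<^sub>F m in sequentially. u - (1 / 2) ^ m \<le> real (nat \<lfloor>u * 2 ^ m\<rfloor>) / 2 ^ m"
      "\<forall>\<^sub>F m in sequentially. real (nat \<lfloor>u * 2 ^ m\<rfloor>) / 2 ^ m \<le> u"
      by simp_all
    have "(\<lambda>m. u - (1 / 2) ^ m) \<longlonglongrightarrow> u - 0"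
      by (intro tendsto_intros LIMSEQ_power_zero) simp
    then show "(\<lambda>m. u - (1 / 2) ^ m) \<longlonglongrightarrow> u"
      by simp
  qed simp
  have L: "(\<lambda>m. real (b m) / 2 ^ m) \<longlonglongrightarrow> l" and S: "(\<lambda>m. real (r m) / 2 ^ m) \<longlonglongrightarrow> s"
    using floor_tendsto s by (auto simp: b_def r_def)
  have less: "\<forall>\<^sub>F m in sequentially. real (r m) / 2 ^ m < real (b m) / 2 ^ m"
    using order_tendstoD[OF tendsto_diff[OF L S], of 0] s by simp
  then have SL: "\<forall>\<^sub>F m in sequentially. 0 \<le> real (r m) / 2 ^ m \<and> real (r m) / 2 ^ m < real (b m) / 2 ^ m"
    by eventually_elim simp
  have "(\<lambda>m. \<bar>pvariation p (shifted_grid (real (b m) / 2 ^ m) (real (r m) / 2 ^ m)) x t -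
      pvariation p (dyadic_grid m) x t\<bar>) \<longlonglongrightarrow> \<bar>pvariation p (shifted_grid l s) x t - v\<bar>"
    by (intro tendsto_rabs tendsto_diff lim pvariation_shifted_grid_tendsto[OF x p t s L S SL])
  moreover have "(\<lambda>m. \<omega> (real (b m) / 2 ^ m)) \<longlonglongrightarrow> \<omega> l"
    by (rule isCont_tendsto_compose[OF \<omega> L])
  moreover have "\<forall>\<^sub>F m in sequentially. \<bar>pvariation p (shifted_grid (real (b m) / 2 ^ m) (real (r m) / 2 ^ m)) x t -
      pvariation p (dyadic_grid m) x t\<bar> \<le> \<omega> (real (b m) / 2 ^ m)"
    using less eventually_ge_at_top[of 1]
  proof eventually_elim
    case (elim m)
    then have rb: "r m < b m"
      by (simp add: divide_less_cancel)
    have "l * 2 ^ m \<le> 2 ^ m"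
      using l by simp
    then have "\<lfloor>l * 2 ^ m\<rfloor> \<le> \<lfloor>2 ^ m :: real\<rfloor>"
      by (rule floor_mono)
    then have "\<lfloor>l * 2 ^ m\<rfloor> \<le> 2 ^ m"
      by simp
    then have "b m \<le> 2 ^ m"
      unfolding b_def by (simp add: nat_le_iff)
    from le[OF elim(2) this rb] show ?case
      unfolding coarse_grid_eq_shifted_grid[OF rb] .
  qed
  ultimately show ?thesis
    using tendsto_le trivial_limit_sequentially by blast
qed

text \<open>A bound that depends on the mesh alone absorbs the suprema over shift and time;
  monotonicity of \<omega> absorbs the one over meshes up to \<open>d\<close>.\<close>

lemma p_roughI:
  assumes "continuous_on {0..1} A" "mono_on {0..1} A" "\<forall>t\<in>{0..1}. 0 \<le> A t" "A 0 = 0" "A 0 < A 1"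
    and \<omega>: "(\<omega> \<longlongrightarrow> 0) (at_right 0)" "mono_on {0<..} \<omega>"
    and le: "\<And>l s t. 0 \<le> s \<Longrightarrow> s < l \<Longrightarrow> l \<le> 1 \<Longrightarrow> t \<in> {0..1} \<Longrightarrow>
      \<bar>pvariation p (shifted_grid l s) x t - A t\<bar> \<le> \<omega> l"
  shows "p_rough p x"
proof -
  define e where "e d = (SUP l\<in>{0<..d}. SUP s\<in>{0..<l}. SUP t\<in>{0..1}.
      ereal \<bar>pvariation p (shifted_grid l s) x t - A t\<bar>)" for d
  have "(e \<longlongrightarrow> 0) (at_right 0)"
  proof (rule tendsto_sandwich)
    show "\<forall>\<^sub>F d in at_right 0. 0 \<le> e d"
      using eventually_at_right_less[of 0]
    proof eventually_elim
      case (elim d)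
      \<comment> \<open>An extended-real supremum over an empty set would be minus infinity, so
        nonnegativity needs a member of each index set.\<close>
      have "0 \<le> ereal \<bar>pvariation p (shifted_grid d 0) x 0 - A 0\<bar>"
        by simp
      also have "\<dots> \<le> e d"
        unfolding e_def using elim by (intro SUP_upper2[of d] SUP_upper2[of 0]) auto
      finally show ?case .
    qed
    have "\<forall>\<^sub>F d in at_right 0. d < (1::real)"
      by (rule eventually_at_right_real[THEN eventually_mono, of 0 1]) auto
    with eventually_at_right_less[of 0] show "\<forall>\<^sub>F d in at_right 0. e d \<le> ereal (\<omega> d)"
    proof eventually_elim
      case (elim d)
      show ?case
        unfolding e_def
      proof (intro SUP_least)
        fix l s t :: real
        assume *: "l \<in> {0<..d}" "s \<in> {0..<l}" "t \<in> {0..1}"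
        then have "\<bar>pvariation p (shifted_grid l s) x t - A t\<bar> \<le> \<omega> l"
          using elim by (intro le) auto
        also have "\<dots> \<le> \<omega> d"
          using * elim by (intro mono_onD[OF \<omega>(2)]) auto
        finally show "ereal \<bar>pvariation p (shifted_grid l s) x t - A t\<bar> \<le> ereal (\<omega> d)"
          by simp
      qed
    qed
    show "((\<lambda>d. ereal (\<omega> d)) \<longlongrightarrow> 0) (at_right 0)"
      using \<omega>(1) by (simp add: zero_ereal_def)
  qed simp
  then show ?thesis
    unfolding p_rough_def e_def using assms by blast
qed

theorem proposition4p3:
  fixes p :: real
  assumes "p > 1"
  shows "\<exists>K :: real \<Rightarrow> real \<Rightarrow> real.
    \<forall>(x :: real \<Rightarrow> real) (c :: nat \<Rightarrow> real) (\<sigma> :: nat \<Rightarrow> nat \<Rightarrow> real) (C :: real) (\<eta> :: real).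
      continuous_on {0..1} x \<longrightarrow>
      bdd_above {2 powr (real m * (1 / p - 1 / 2)) * \<bar>fs_coeff x m k\<bar> | m k. k < 2 ^ m} \<longrightarrow>
      x \<in> V_dyadic p \<longrightarrow>
      dyadic_pvar p x 1 > 0 \<longrightarrow>
      (\<forall>m k. k < 2 ^ m \<longrightarrow> fs_coeff x m k = c m * \<sigma> m k \<and> \<sigma> m k \<in> {- 1, 1}) \<longrightarrow>
      0 < \<eta> \<longrightarrow> \<eta> \<le> 1 \<longrightarrow>
      (\<forall>m b r q\<^sub>0 M. 1 \<le> m \<longrightarrow> 1 \<le> b \<longrightarrow> b \<le> 2 ^ m \<longrightarrow> r < b \<longrightarrow> 1 \<le> M \<longrightarrow>
         (\<forall>q\<in>{q\<^sub>0..<q\<^sub>0 + M}. full_block m b r q) \<longrightarrow>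
         \<bar>\<Sum>q = q\<^sub>0..<q\<^sub>0 + M. G p m b r q (x 1 - x 0) (\<lambda>m k. c m * \<sigma> m k)\<bar>
           \<le> C * real M powr (1 - \<eta>)) \<longrightarrow>
      p_rough p x \<and>
      (\<exists>H. holder_bound p x H) \<and>
      (\<forall>H L. holder_bound p x H \<longrightarrow> 2 \<le> L \<longrightarrow>
         coarse_error p L x \<le> ereal (K H C * (real L powr (- \<eta>) + 1 / real L)))"
proof (intro exI[where x = "\<lambda>H C. C + 2 * H powr p"] allI impI)
  fix x :: "real \<Rightarrow> real" and c :: "nat \<Rightarrow> real" and \<sigma> :: "nat \<Rightarrow> nat \<Rightarrow> real" and C \<eta> :: real
  assume x: "continuous_on {0..1} x"
    and bdd: "bdd_above {2 powr (real m * (1 / p - 1 / 2)) * \<bar>fs_coeff x m k\<bar> | m k. k < 2 ^ m}"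
    and V: "x \<in> V_dyadic p" and pos: "dyadic_pvar p x 1 > 0"
    and \<sigma>: "\<forall>m k. k < 2 ^ m \<longrightarrow> fs_coeff x m k = c m * \<sigma> m k \<and> \<sigma> m k \<in> {- 1, 1}"
    and \<eta>: "0 < \<eta>" "\<eta> \<le> 1"
    and blocks: "\<forall>m b r q\<^sub>0 M. 1 \<le> m \<longrightarrow> 1 \<le> b \<longrightarrow> b \<le> 2 ^ m \<longrightarrow> r < b \<longrightarrow> 1 \<le> M \<longrightarrow>
         (\<forall>q\<in>{q\<^sub>0..<q\<^sub>0 + M}. full_block m b r q) \<longrightarrow>
         \<bar>\<Sum>q = q\<^sub>0..<q\<^sub>0 + M. G p m b r q (x 1 - x 0) (\<lambda>m k. c m * \<sigma> m k)\<bar>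
           \<le> C * real M powr (1 - \<eta>)"
  have p: "0 < p" using assms by simp
  define \<theta> where "\<theta> = (\<lambda>m k. c m * \<sigma> m k)"
  have \<theta>: "\<theta> m k = fs_coeff x m k" if "k < 2 ^ m" for m k
    using \<sigma> that by (simp add: \<theta>_def)
  have blocks': "\<bar>\<Sum>q<M. G p m b r q (x 1 - x 0) \<theta>\<bar> \<le> C * real M powr (1 - \<eta>)"
    if "1 \<le> m" "b \<le> 2 ^ m" "r < b" "1 \<le> M" "\<forall>q<M. full_block m b r q" for m b r M
    using blocks[rule_format, of m b r M 0] that by (simp add: \<theta>_def atLeast0LessThan)
  \<comment> \<open>The block hypothesis for the single block with \<open>m = b = M = 1\<close> and
    \<open>r = 0\<close> bounds an absolute value by \<open>C\<close>.\<close>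
  have "0 \<le> C"
    using order_trans[OF abs_ge_zero blocks'[of 1 1 0 1]] by (simp add: full_block_def)
  define \<omega> where "\<omega> H h = C * h powr \<eta> + 2 * H powr p * h" for H h
  have le: "\<bar>pvariation p (coarse_grid m b r) x t - pvariation p (dyadic_grid m) x t\<bar> \<le> \<omega> H (real b / 2 ^ m)"
    if "holder_bound p x H" "0 \<le> t" "t \<le> 1" "1 \<le> m" "b \<le> 2 ^ m" "r < b" for H m b r t
    unfolding \<omega>_def using that
    by (intro coarse_pvariation_diff_le_powr[OF assms, where \<theta> = \<theta>] \<theta> \<eta> \<open>0 \<le> C\<close> blocks')
  have mono: "\<omega> H h \<le> \<omega> H h'" if "0 \<le> h" "h \<le> h'" for H h h'
    unfolding \<omega>_def using that \<open>0 \<le> C\<close> \<eta> by (intro add_mono mult_left_mono powr_mono2) auto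
  obtain H where H: "holder_bound p x H"
    using holder_bound_if_fs_coeff_bounded[OF assms x bdd] by blast
  have "p_rough p x"
  proof -
    \<comment> \<open>This is the same choice as in \<open>dyadic_pvar\<close>, so positivity of the
      dyadic variation transfers directly.\<close>
    define \<mu> where "\<mu> = (SOME \<mu>. is_dyadic_limit p x \<mu>)"
    have \<mu>: "is_dyadic_limit p x \<mu>"
      unfolding \<mu>_def using V by (auto simp: V_dyadic_def intro: someI)
    let ?A = "unit_cdf \<mu>"
    show ?thesis
    proof (rule p_roughI)
      show "continuous_on {0..1} ?A"
        using isCont_unit_cdf[OF \<mu>] by (intro continuous_at_imp_continuous_on) auto
      show "mono_on {0..1} ?A"
        using mono_unit_cdf[OF \<mu>] by (auto simp: mono_on_def mono_def)
      show "\<forall>t\<in>{0..1}. 0 \<le> ?A t"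
        by (simp add: unit_cdf_def)
      show A0: "?A 0 = 0"
        by (rule unit_cdf_0[OF \<mu>])
      show "?A 0 < ?A 1"
        using pos unfolding A0 dyadic_pvar_def \<mu>_def[symmetric] by (simp add: unit_cdf_eq[OF \<mu>])
      have "\<forall>\<^sub>F h in at_right (0::real). 0 \<le> h"
        using eventually_at_right_less[of 0] by eventually_elim simp
      then have "((\<lambda>h. h powr \<eta>) \<longlongrightarrow> 0 powr \<eta>) (at_right 0)"
        using \<eta> by (intro tendsto_powr' tendsto_const tendsto_ident_at) auto
      then have "((\<lambda>h. \<omega> H h) \<longlongrightarrow> C * 0 powr \<eta> + 2 * H powr p * 0) (at_right 0)"
        unfolding \<omega>_def by (intro tendsto_add tendsto_mult tendsto_const tendsto_ident_at)
      then show "(\<omega> H \<longlongrightarrow> 0) (at_right 0)"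
        by simp
      show "mono_on {0<..} (\<omega> H)"
        using mono by (auto simp: mono_on_def)
      fix l s t :: real
      assume *: "0 \<le> s" "s < l" "l \<le> 1" "t \<in> {0..1}"
      show "\<bar>pvariation p (shifted_grid l s) x t - ?A t\<bar> \<le> \<omega> H l"
      proof (rule grid_limit_le[OF p x _ _ *(1-3)])
        show "(\<lambda>m. pvariation p (dyadic_grid m) x t) \<longlonglongrightarrow> ?A t"
          using * by (intro pvariation_dyadic_grid_tendsto[OF \<mu> p H]) auto
        show "isCont (\<omega> H) l"
          unfolding \<omega>_def using * by (intro continuous_intros) auto
      qed (use * le[OF H] in auto)
    qed
  qed
  moreover have "coarse_error p L x \<le> ereal ((C + 2 * H powr p) * (real L powr - \<eta> + 1 / real L))"
    if H: "holder_bound p x H" and L: "2 \<le> L" for H L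
  proof -
    \<comment> \<open>The constant is the sum of the coefficients of \<open>L powr - \<eta>\<close>
      and \<open>1 / L\<close> in \<omega>; the cross terms are nonnegative.\<close>
    have "\<omega> H (1 / real L) \<le> (C + 2 * H powr p) * (real L powr - \<eta> + 1 / real L)"
    proof -
      have "\<omega> H (1 / real L) = C * real L powr - \<eta> + 2 * H powr p * (1 / real L)"
        using L by (simp add: \<omega>_def powr_divide powr_minus_divide)
      moreover have "0 \<le> C * (1 / real L)" "0 \<le> 2 * H powr p * real L powr - \<eta>"
        using \<open>0 \<le> C\<close> by auto
      ultimately show ?thesis
        by (simp only: distrib_left distrib_right)
    qed
    \<comment> \<open>The range \<open>b \<le> 2 ^ m div L\<close> means mesh at most
      \<open>1 / L\<close>, so monotonicity of \<omega> gives the bound at every level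
      \<open>m \<ge> 1\<close>.\<close>
    moreover have "coarse_error p L x \<le> ereal (\<omega> H (1 / real L))"
      unfolding coarse_error_def
    proof (rule Limsup_bounded)
      show "\<forall>\<^sub>F m in sequentially. (SUP (b, r)\<in>{(b, r). L \<le> b \<and> b \<le> 2 ^ m div L \<and> r < b}. SUP t\<in>{0..1}.
          ereal \<bar>pvariation p (coarse_grid m b r) x t - pvariation p (dyadic_grid m) x t\<bar>) \<le> ereal (\<omega> H (1 / real L))"
        using eventually_ge_at_top[of 1]
      proof eventually_elim
        case (elim m)
        have "ereal \<bar>pvariation p (coarse_grid m b r) x t - pvariation p (dyadic_grid m) x t\<bar> \<le> ereal (\<omega> H (1 / real L))"
          if b: "b \<le> 2 ^ m div L" "r < b" and t: "0 \<le> t" "t \<le> 1" for b r t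
        proof -
          have "L * b \<le> L * (2 ^ m div L)"
            using b by simp
          also have "\<dots> \<le> 2 ^ m"
            by simp
          finally have Lb: "L * b \<le> 2 ^ m" .
          then have "real (L * b) \<le> real (2 ^ m)"
            by (simp only: of_nat_le_iff)
          then have "real b / 2 ^ m \<le> 1 / real L"
            using L by (simp add: field_simps)
          moreover have "b \<le> 2 ^ m"
            using b(1) div_le_dividend order_trans by blast
          ultimately show ?thesis
            using le[OF H t elim _ b(2)] mono[of "real b / 2 ^ m" "1 / real L" H] by simp
        qed
        then show ?case
          by (intro SUP_least) (auto intro!: SUP_least)
      qed
    qed
    ultimately show ?thesis
      by (meson ereal_less_eq(3) order_trans)
  qed
  ultimately show "p_rough p x \<and> (\<exists>H. holder_bound p x H) \<and>
      (\<forall>H L. holder_bound p x H \<longrightarrow> 2 \<le> L \<longrightarrow>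
         coarse_error p L x \<le> ereal ((C + 2 * H powr p) * (real L powr - \<eta> + 1 / real L)))"
    using H by blast
qed

end
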